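(* Let $a_{i,j}(n)$ denote the number of walks on the square lattice $\mathbb{Z}^2$ with $n$ steps, each step being one of $(\pm1,0),(0,\pm1)$, that start at $(0,0)$, end at $(i,j)$, and never touch a point $(-k,0)$ with $k\ge0$ after the starting point. Then for $i\ge1$ and $n\ge i$, $$a_{-i,-i}(2n)=\frac{i}{2n}\binom{2i}{i}\binom{n+i}{2i}\frac{\binom{4n}{2n}}{\binom{2n+2i}{2i}},$$ $$a_{i,i}(2n)=a_{-i,-i}(2n)+4^n\,\frac{i}{n}\binom{2i}{i}\binom{2n}{n-i}.$$
   Formalization: The second identity is false as printed (for i=n=1 the left side is 2, the right side 9); the last summand is corrected from 4^n (i/n) C(2i,i) C(2n,n-i) to 4^(n-i) (i/(2n)) C(2i,i) C(2n,n-i). *)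

theory Defs
  imports Complex_Main "HOL-Library.Product_Plus"
begin

definition unit_steps :: "(int \<times> int) set" where
  "unit_steps = {(1, 0), (-1, 0), (0, 1), (0, -1)}"

definition slit :: "(int \<times> int) set" where
  "slit = {(- int k, 0) |k. True}"

text \<open>A walk with \<open>n\<close> steps is the list of its \<open>n + 1\<close> vertices.\<close>

definition slit_walks :: "int \<Rightarrow> int \<Rightarrow> nat \<Rightarrow> (int \<times> int) list set" where
  "slit_walks i j n =
     {w. length w = n + 1 \<and> w ! 0 = (0, 0) \<and> w ! n = (i, j) \<and>
         (\<forall>k<n. w ! (k + 1) - w ! k \<in> unit_steps) \<and>
         (\<forall>k\<in>{1..n}. w ! k \<notin> slit)}"

definition slit_walk_count :: "int \<Rightarrow> int \<Rightarrow> nat \<Rightarrow> nat" where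
  "slit_walk_count i j n = card (slit_walks i j n)"

lemma slit_walk_count_1_1_2: "slit_walk_count 1 1 2 = 2"
proof -
  have "slit_walks 1 1 2 = {[(0, 0), (1, 0), (1, 1)], [(0, 0), (0, 1), (1, 1)]}" (is "?L = ?R")
  proof
    show "?L \<subseteq> ?R"
    proof
      fix w assume w: "w \<in> ?L"
      then have "length w = Suc (Suc (Suc 0))" by (simp add: slit_walks_def)
      then obtain a b c where abc: "w = [a, b, c]"
        by (auto simp: length_Suc_conv)
      have ends: "a = (0, 0)" "c = (1, 1)"
        using w abc by (auto simp: slit_walks_def numeral_2_eq_2)
      have "w ! (0 + 1) - w ! 0 \<in> unit_steps" "w ! (1 + 1) - w ! 1 \<in> unit_steps"
        using w unfolding slit_walks_def by (force, force)
      then show "w \<in> ?R"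
        using abc ends by (cases b) (auto simp: unit_steps_def)
    qed
  next
    have "{1..2} = {1, 2::nat}" by auto
    then show "?R \<subseteq> ?L"
      by (auto simp: slit_walks_def slit_def unit_steps_def less_Suc_eq numeral_2_eq_2)
  qed
  then show ?thesis by (simp add: slit_walk_count_def)
qed

text \<open>
  The source states the formula for \<open>a\<^sub>i\<^sub>,\<^sub>i(2n)\<close> with the summand
  \<open>4^n (i/n) (2i choose i) (2n choose (n - i))\<close>. That formula is false, as the next
  lemma shows for \<open>i = n = 1\<close>. The corrected summand used instead is
  \<open>4^(n - i) (i/(2n)) (2i choose i) (2n choose (n - i))\<close>, which is smaller by the factor
  \<open>2 \<cdot> 4^i\<close> and agrees with exact enumeration for all \<open>1 \<le> i \<le> n \<le> 20\<close>.
\<close>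

lemma uncorrected_diagonal_formula_fails:
  fixes i n :: nat
  assumes "i = 1" "n = 1"
  shows "real (slit_walk_count (int i) (int i) (2 * n)) \<noteq>
           real (slit_walk_count (- int i) (- int i) (2 * n))
           + 4 ^ n * (real i / real n) * real ((2 * i) choose i) * real ((2 * n) choose (n - i))"
  using assms slit_walk_count_1_1_2 by simp

end

(*
  Let a_j(x) be the generating function (in t) of the walks ending on the line y = j. The kernel
  equation makes a_j decay geometrically in |j|, which leaves
    a_0(x)^2 ((1 - t(x + 1/x))^2 - 4t^2) = S(1/x)^2,
  where 1 - S(1/x) counts the walks that end at their first return to the slit. As a_0 has only
  nonnegative powers of x, Wiener-Hopf factorization of the left side gives S(y)^2 = (c - ty)(d - ty)
  with c, d explicit in terms of the Catalan series. Eliminating the other diagonals in the same way,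
  the series D of the walks ending on x = y satisfies (D R)^2 = (c - tX)(d - tX) for explicit
  algebraic R and X; with z marking the position on the diagonal, w^2 = 1 + G and
  G = 4t^2 (1 + G)^2, this is solved by
    2 (1 + z) D = (1 + z) (1 - Gz)^(-1/2) + w (z (1 - Gz)^(-1/2) + (1 - G/z)^(-1/2)),
  and the coefficients of G^i and w G^i are ballot numbers.
  All series are power series in t over the reals; x, y, z and p = sqrt z are real parameters in
  which every coefficient is a Laurent polynomial.
*)
theory Submission
  imports Defs "HOL-Computational_Algebra.Formal_Laurent_Series" "HOL-Library.Groups_Big_Fun"
begin

unbundle fps_syntax

subsection \<open>Counting by the last step\<close>

text \<open>No square root is ever chosen. A kernel root is the fixpoint of a t-adic contraction,
  hence the root that is a power series; the same contraction makes solutions of the kernel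
  recurrence unique without a growth condition at infinity. Where only a square is known, as for D,
  the constant term in t decides the sign. The diagonals are harder than the rows: the slit meets
  every diagonal x - y = j with j <= 0, so only those with j > 0 decay geometrically. Summing the
  remaining equations against powers of the kernel root V telescopes and leaves S evaluated at X = V
  / p. This X is a power series in t, whereas the factorization gives S(y)^2 for real y; so that
  result is first turned into an identity between the coefficients of S. The closed form of D rests
  on 2 (1 + z) t X = 1 - R and w^2 R = ((1 - G z) (1 - G/z))^(1/2), with c + d and c d rational in
  w.\<close>

lemma slit_walks_0: "slit_walks i j 0 = (if (i, j) = (0, 0) then {[(0, 0)]} else {})"
  by (auto simp: slit_walks_def length_Suc_conv)

lemma slit_walks_Suc:
  assumes "(i, j) \<notin> slit"
  shows "slit_walks i j (Suc n) =
    (\<Union>s\<in>unit_steps. (\<lambda>w. w @ [(i, j)]) ` slit_walks (i - fst s) (j - snd s) n)"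
proof (intro equalityI subsetI)
  fix v assume v: "v \<in> slit_walks i j (Suc n)"
  then have len: "length v = Suc (Suc n)" by (simp add: slit_walks_def)
  then obtain w y where vw: "v = w @ [y]" by (metis Zero_not_Suc length_0_conv rev_exhaust)
  then have lw: "length w = Suc n" using len by simp
  have y: "y = (i, j)" using v lw vw by (simp add: slit_walks_def nth_append)
  define s where "s = (i, j) - w ! n"
  have st: "v ! (k + 1) - v ! k \<in> unit_steps" if "k < Suc n" for k
    using v that by (simp add: slit_walks_def)
  have "s \<in> unit_steps" using st[of n] vw lw y by (simp add: s_def nth_append)
  moreover have "w \<in> slit_walks (i - fst s) (j - snd s) n"
  proof -
    have "w ! 0 = (0, 0)" using v vw lw by (simp add: slit_walks_def nth_append)
    moreover have "w ! n = (i - fst s, j - snd s)" by (cases "w ! n") (simp add: s_def)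
    moreover have "w ! (k + 1) - w ! k \<in> unit_steps" if "k < n" for k
      using st[of k] that vw lw by (simp add: nth_append)
    moreover have "w ! k \<notin> slit" if "k \<in> {1..n}" for k
      using v that vw lw by (force simp: slit_walks_def nth_append)
    ultimately show ?thesis using lw by (simp add: slit_walks_def)
  qed
  ultimately show "v \<in> (\<Union>s\<in>unit_steps. (\<lambda>w. w @ [(i, j)]) ` slit_walks (i - fst s) (j - snd s) n)"
    using vw y by blast
next
  fix v assume "v \<in> (\<Union>s\<in>unit_steps. (\<lambda>w. w @ [(i, j)]) ` slit_walks (i - fst s) (j - snd s) n)"
  then obtain s w where s: "s \<in> unit_steps" and v: "v = w @ [(i, j)]"
    and w: "w \<in> slit_walks (i - fst s) (j - snd s) n" by blast
  have lw: "length w = Suc n" using w by (simp add: slit_walks_def)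
  have "v ! (k + 1) - v ! k \<in> unit_steps" if "k < Suc n" for k
  proof (cases "k = n")
    case True
    then show ?thesis using w s v lw by (simp add: slit_walks_def nth_append)
  next
    case False
    then show ?thesis using w v that lw by (simp add: slit_walks_def nth_append)
  qed
  moreover have "v ! k \<notin> slit" if "k \<in> {1..Suc n}" for k
    using w v that lw assms by (cases "k = Suc n") (auto simp: slit_walks_def nth_append)
  ultimately show "v \<in> slit_walks i j (Suc n)"
    using v w lw by (simp add: slit_walks_def nth_append)
qed

lemma slit_walks_Suc_on_slit: "(i, j) \<in> slit \<Longrightarrow> slit_walks i j (Suc n) = {}"
  by (force simp: slit_walks_def)

lemma finite_slit_walks: "finite (slit_walks i j n)"
proof (induction n arbitrary: i j)
  case (Suc n)
  then show ?case
    by (cases "(i, j) \<in> slit") (auto simp: slit_walks_Suc_on_slit slit_walks_Suc unit_steps_def)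
qed (simp add: slit_walks_0)

definition walks :: "int \<Rightarrow> int \<Rightarrow> nat \<Rightarrow> real" where
  "walks i j n = real (slit_walk_count i j n)"

definition inflow :: "int \<Rightarrow> int \<Rightarrow> nat \<Rightarrow> real" where
  "inflow i j n = walks (i - 1) j n + walks (i + 1) j n + walks i (j - 1) n + walks i (j + 1) n"

lemma walks_0: "walks i j 0 = (if i = 0 \<and> j = 0 then 1 else 0)"
  by (simp add: walks_def slit_walk_count_def slit_walks_0)

lemma walks_Suc: "walks i j (Suc n) = (if (i, j) \<in> slit then 0 else inflow i j n)"
proof (cases "(i, j) \<in> slit")
  case True
  then show ?thesis by (simp add: walks_def slit_walk_count_def slit_walks_Suc_on_slit)
next
  case False
  have fin: "finite unit_steps" by (simp add: unit_steps_def)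
  let ?S = "\<lambda>s. (\<lambda>w. w @ [(i, j)]) ` slit_walks (i - fst s) (j - snd s) n"
  have disj: "?S s \<inter> ?S s' = {}" if "s \<noteq> s'" for s s'
    using that by (fastforce simp: slit_walks_def prod_eq_iff)
  have "card (slit_walks i j (Suc n)) = (\<Sum>s\<in>unit_steps. card (?S s))"
    unfolding slit_walks_Suc[OF False]
    by (rule card_UN_disjoint) (use fin disj finite_slit_walks in auto)
  also have "\<dots> = (\<Sum>s\<in>unit_steps. slit_walk_count (i - fst s) (j - snd s) n)"
    unfolding walks_def slit_walk_count_def by (intro sum.cong refl card_image) (simp add: inj_on_def)
  finally show ?thesis using False
    by (simp add: walks_def slit_walk_count_def inflow_def unit_steps_def)
qed

lemma mem_slit: "(i, j) \<in> slit \<longleftrightarrow> i \<le> 0 \<and> j = 0"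
proof
  assume "i \<le> 0 \<and> j = 0"
  then have "(i, j) = (- int (nat (- i)), 0)" by simp
  then show "(i, j) \<in> slit" unfolding slit_def by blast
qed (auto simp: slit_def)

lemma walks_eq_0: "\<bar>i\<bar> + \<bar>j\<bar> > int n \<Longrightarrow> walks i j n = 0"
proof (induction n arbitrary: i j)
  case 0
  then show ?case by (auto simp: walks_0)
next
  case (Suc n)
  then have "walks (i - 1) j n = 0" "walks (i + 1) j n = 0" "walks i (j - 1) n = 0" "walks i (j + 1) n = 0"
    by (auto intro!: Suc.IH)
  then show ?case by (simp add: walks_Suc inflow_def)
qed

subsection \<open>Recursive power series and ballot numbers\<close>

text \<open>Divisibility by powers of \<open>fps_X\<close> expresses t-adic closeness; the limit and
  uniqueness arguments below are phrased in it.\<close>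

lemma fps_X_power_dvd_iff: "fps_X ^ n dvd f \<longleftrightarrow> (\<forall>k<n. f $ k = 0)" for f :: "real fps"
proof
  assume "\<forall>k<n. f $ k = 0"
  then have "f = fps_X ^ n * fps_shift n f"
    by (intro fps_ext) (simp add: fps_X_power_mult_nth)
  then show "fps_X ^ n dvd f" by (metis dvd_triv_left)
qed (auto simp: fps_X_power_mult_nth)

lemma fps_X_power_dvd_imp_eq_0: "f = 0" if "\<And>n. fps_X ^ n dvd f" for f :: "real fps"
  using that fps_X_power_dvd_iff by (intro fps_ext) (metis fps_zero_nth lessI)

text \<open>The factor \<open>fps_X\<close> makes the right side a t-adic contraction
  (\<open>contr\<close>), so its iterates from 0 converge. The kernel roots are obtained in this
  way.\<close>

lemma fps_quadratic_fixpoint: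
  fixes a b c :: "real fps"
  obtains Y where "Y = fps_X * (a + b * Y + c * Y\<^sup>2)"
proof -
  define \<Phi> where "\<Phi> Y = fps_X * (a + b * Y + c * Y\<^sup>2)" for Y
  have contr: "fps_X ^ Suc n dvd \<Phi> A - \<Phi> B" if "fps_X ^ n dvd A - B" for n A B
  proof -
    have "\<Phi> A - \<Phi> B = fps_X * ((A - B) * (b + c * (A + B)))"
      by (simp add: \<Phi>_def algebra_simps power2_eq_square)
    then show ?thesis using that by (simp add: dvd_mult2)
  qed
  define y where "y m = (\<Phi> ^^ m) 0" for m
  have y_Suc: "y (Suc m) = \<Phi> (y m)" for m by (simp add: y_def)
  have step: "fps_X ^ m dvd y (Suc m) - y m" for m
  proof (induction m)
    case (Suc m)
    then show ?case using contr[OF Suc] by (simp only: y_Suc)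
  qed simp
  have cauchy: "fps_X ^ m dvd y (m + d) - y m" for m d
  proof (induction d)
    case (Suc d)
    have "fps_X ^ m dvd y (Suc (m + d)) - y (m + d)"
      using step[of "m + d"] by (metis dvd_trans le_add1 le_imp_power_dvd)
    then show ?case using dvd_add[OF _ Suc] by fastforce
  qed simp
  \<comment> \<open>From iterate \<open>Suc n\<close> on, the coefficient of index \<open>n\<close>
    no longer changes.\<close>
  define Y where "Y = Abs_fps (\<lambda>n. y (Suc n) $ n)"
  have near: "fps_X ^ m dvd Y - y m" for m
    unfolding fps_X_power_dvd_iff
  proof (intro allI impI)
    fix k assume "k < m"
    then obtain d where d: "m = Suc k + d" using less_iff_Suc_add by auto
    show "(Y - y m) $ k = 0"
      using cauchy[of "Suc k" d] unfolding fps_X_power_dvd_iff by (auto simp: d Y_def)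
  qed
  have "fps_X ^ n dvd Y - \<Phi> Y" for n
  proof -
    have "fps_X ^ Suc n dvd (Y - y (Suc n)) - (\<Phi> Y - \<Phi> (y n))"
      using near[of "Suc n"] contr[OF near[of n]] by (rule dvd_diff)
    then have "fps_X ^ Suc n dvd Y - \<Phi> Y" by (simp add: y_Suc)
    then show ?thesis by (metis dvd_mult_right power_Suc)
  qed
  then have "Y - \<Phi> Y = 0" by (rule fps_X_power_dvd_imp_eq_0)
  then have "Y = \<Phi> Y" by simp
  then show ?thesis using that unfolding \<Phi>_def by blast
qed

text \<open>Each use of the recurrence gains a factor \<open>fps_X\<close> for all indices at once,
  so every \<open>E j\<close> is divisible by all powers of it.\<close>

lemma fps_recurrence_eq_0:
  fixes E :: "nat \<Rightarrow> real fps"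
  assumes "E 0 = 0"
    and rec: "\<And>j. E (Suc j) = fps_X * (a * E j + b * E (Suc j) + c * E (Suc (Suc j)))"
  shows "E j = 0"
proof -
  have "fps_X ^ n dvd E j" for n j
  proof (induction n arbitrary: j)
    case (Suc n)
    show ?case
    proof (cases j)
      case (Suc k)
      have "fps_X ^ Suc n dvd fps_X * (a * E k + b * E (Suc k) + c * E (Suc (Suc k)))"
        unfolding power_Suc by (intro mult_dvd_mono dvd_add dvd_mult Suc.IH dvd_refl)
      then show ?thesis unfolding Suc rec[of k, symmetric] .
    qed (simp add: assms(1))
  qed simp
  then show ?thesis by (rule fps_X_power_dvd_imp_eq_0)
qed

lemma recurrence_factor:
  fixes x :: "'a :: comm_ring_1"
  shows "x * (a * p + b * q + c * r) - x * ((a + b * y + c * y\<^sup>2) * z) =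
    x * (a * (p - z) + b * (q - y * z) + c * (r - y * (y * z)))"
  by (simp add: algebra_simps power2_eq_square)

text \<open>The difference \<open>C j - Y ^ j * C 0\<close> solves the same recurrence and vanishes
  at 0, because \<open>Y\<close> is a root of the characteristic equation.\<close>

lemma fps_recurrence_geometric:
  fixes C :: "nat \<Rightarrow> real fps"
  assumes Y: "Y = fps_X * (a + b * Y + c * Y\<^sup>2)"
    and C: "\<And>j. C (Suc j) = fps_X * (a * C j + b * C (Suc j) + c * C (Suc (Suc j)))"
  shows "C j = Y ^ j * C 0"
proof -
  define E where "E j = C j - Y ^ j * C 0" for j
  have rec: "E (Suc j) = fps_X * (a * E j + b * E (Suc j) + c * E (Suc (Suc j)))" for j
  proof -
    let ?R = "fps_X * (a + b * Y + c * Y\<^sup>2) * (Y ^ j * C 0)"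
    have "Y ^ Suc j * C 0 = Y * (Y ^ j * C 0)" by (simp only: power_Suc mult.assoc)
    also have "\<dots> = ?R" by (rule arg_cong[where f = "\<lambda>u. u * (Y ^ j * C 0)", OF Y])
    finally have "E (Suc j) = C (Suc j) - ?R" by (simp only: E_def)
    also have "\<dots> = fps_X * (a * C j + b * C (Suc j) + c * C (Suc (Suc j))) - ?R"
      by (rule arg_cong[where f = "\<lambda>u. u - ?R", OF C])
    also have "\<dots> = fps_X * (a * E j + b * E (Suc j) + c * E (Suc (Suc j)))"
      unfolding E_def power_Suc mult.assoc by (rule recurrence_factor)
    finally show ?thesis .
  qed
  have "E 0 = 0" by (simp add: E_def)
  then have "E j = 0" using rec by (rule fps_recurrence_eq_0)
  then show ?thesis by (simp add: E_def)
qed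

section \<open>Ballot numbers and their generating series\<close>

definition gbin :: "real \<Rightarrow> int \<Rightarrow> real" where
  "gbin a k = (if k < 0 then 0 else a gchoose nat k)"

lemma gbin_pascal: "gbin (a + 1) k = gbin a k + gbin a (k - 1)"
proof -
  consider "k < 0" | "k = 0" | m where "k = int (Suc m)"
    by (metis not_less_iff_gr_or_eq zero_less_imp_eq_int gr0_implies_Suc)
  then show ?thesis
  proof cases
    case (3 m)
    have "int (Suc m) - 1 = int m" by simp
    then show ?thesis unfolding 3 gbin_def by (simp only: nat_int) (simp add: gbinomial_Suc_Suc)
  qed (auto simp: gbin_def)
qed

lemma gbin_pascal2: "gbin (a + 2) k = gbin a k + 2 * gbin a (k - 1) + gbin a (k - 2)"
  using gbin_pascal[of "a + 1" k] gbin_pascal[of a k] gbin_pascal[of a "k - 1"]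
  by (simp add: add.commute)

text \<open>This is \<open>(2i + a) / (2n + a) (2n + a choose n - i)\<close>, written as a difference to avoid
  \<open>0 / 0\<close> at \<open>a = n = 0\<close>.\<close>

definition ballot :: "real \<Rightarrow> nat \<Rightarrow> nat \<Rightarrow> real" where
  "ballot a i n = gbin (2 * real n + a - 1) (int n - int i) - gbin (2 * real n + a - 1) (int n - int i - 1)"

text \<open>Pascal's rule twice, as the upper index grows by 2 with \<open>n\<close>; the value 0 of
  \<open>gbin\<close> at negative lower index spares all boundary cases. The weights 1, 2, 1 give
  the characteristic equation Y = t (1 + Y)^2.\<close>

lemma ballot_Suc_Suc:
  "ballot a (Suc i) (Suc n) = ballot a i n + 2 * ballot a (Suc i) n + ballot a (Suc (Suc i)) n"
proof -
  have e: "2 * real (Suc n) + a - 1 = (2 * real n + a - 1) + 2" by simp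
  have e1: "int (Suc n) - int (Suc i) = int n - int i" by simp
  show ?thesis unfolding ballot_def e e1 gbin_pascal2
    by (simp add: algebra_simps)
qed

lemma ballot_0_right: "ballot a (Suc i) 0 = 0" "ballot a 0 0 = 1"
  by (auto simp: ballot_def gbin_def)

text \<open>With C the series \<open>cat_fps\<close>, this is C^i (1 + C)^a. The exponents of
  interest are a = 0 and a = 1/2.\<close>

definition ballot_fps :: "real \<Rightarrow> nat \<Rightarrow> real fps" where
  "ballot_fps a i = Abs_fps (ballot a i)"

lemma ballot_fps_Suc:
  "ballot_fps a (Suc i) = fps_X * (1 * ballot_fps a i + 2 * ballot_fps a (Suc i) + 1 * ballot_fps a (Suc (Suc i)))"
proof (rule fps_ext)
  fix n show "ballot_fps a (Suc i) $ n = (fps_X * (1 * ballot_fps a i + 2 * ballot_fps a (Suc i) + 1 * ballot_fps a (Suc (Suc i)))) $ n"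
    by (cases n) (simp_all add: ballot_fps_def ballot_0_right ballot_Suc_Suc numeral_fps_const)
qed

text \<open>By absorption, N = 2n + a times either binomial of the difference is a multiple of
  \<open>N gchoose (n - i)\<close>.\<close>

lemma ballot_eq:
  assumes "i \<le> n" "n \<ge> 1" "a \<ge> 0"
  shows "ballot a i n = (2 * real i + a) / (2 * real n + a) * ((2 * real n + a) gchoose (n - i))"
proof -
  define N where "N = 2 * real n + a"
  have N: "N > 0" using assms by (simp add: N_def)
  show ?thesis
  proof (cases "n - i")
    case 0
    then have "n = i" using assms by simp
    then show ?thesis using N by (simp add: ballot_def gbin_def N_def)
  next
    case (Suc m)
    then have nm: "real n - real i = real (Suc m)" by linarith
    have "ballot a i n = ((N - 1) gchoose Suc m) - ((N - 1) gchoose m)"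
    proof -
      have "int n - int i = int (Suc m)" "int n - int i - 1 = int m" using Suc by linarith+
      then show ?thesis unfolding ballot_def gbin_def N_def by (simp only: nat_int) simp
    qed
    moreover have "N * ((N - 1) gchoose m) = real (Suc m) * (N gchoose Suc m)"
      by (metis gbinomial_absorption)
    moreover have "N * ((N - 1) gchoose Suc m) = (N - real (Suc m)) * (N gchoose Suc m)"
      by (metis gbinomial_absorb_comp)
    ultimately have "N * ballot a i n = (N - 2 * real (Suc m)) * (N gchoose Suc m)"
      by (simp only: right_diff_distrib left_diff_distrib)
    moreover have "N - 2 * real (Suc m) = 2 * real i + a" using nm by (simp add: N_def)
    ultimately have "N * ballot a i n = (2 * real i + a) * (N gchoose (n - i))"
      using Suc by simp
    then have "ballot a i n = (2 * real i + a) * (N gchoose (n - i)) / N"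
      using N by (simp add: eq_divide_eq mult.commute)
    then show ?thesis by (simp add: N_def)
  qed
qed

lemma ballot_fps_0_0: "ballot_fps 0 0 = 1"
proof (rule fps_ext)
  fix n show "ballot_fps 0 0 $ n = 1 $ n"
    by (cases n) (simp_all add: ballot_fps_def ballot_0_right ballot_eq)
qed

definition cat_fps :: "real fps" where
  "cat_fps = ballot_fps 0 1"

text \<open>For a = 0 the ballot series form a geometric sequence whose ratio Y solves Y = t (1 +
  Y)^2. The term of index 0 is 1, so the term of index 1 is Y itself.\<close>

lemma cat_fps_eq: "cat_fps = fps_X * (1 + cat_fps)\<^sup>2"
proof -
  obtain Y :: "real fps" where Y: "Y = fps_X * (1 + 2 * Y + 1 * Y\<^sup>2)"
    by (rule fps_quadratic_fixpoint)
  have geo: "ballot_fps 0 i = Y ^ i * ballot_fps 0 0" for i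
    using fps_recurrence_geometric[OF Y, of "ballot_fps 0"] ballot_fps_Suc by blast
  have c: "cat_fps = Y"
    unfolding cat_fps_def geo[of 1] by (simp add: ballot_fps_0_0)
  show "cat_fps = fps_X * (1 + cat_fps)\<^sup>2"
    unfolding c
  proof -
    have "fps_X * (1 + 2 * Y + 1 * Y\<^sup>2) = fps_X * (1 + Y)\<^sup>2"
      by (simp add: power2_sum)
    then show "Y = fps_X * (1 + Y)\<^sup>2" using Y by (rule trans[rotated])
  qed
qed

lemma fps_compose_4X2_nth:
  "(f oo (fps_const 4 * fps_X\<^sup>2)) $ n = (if even n then 4 ^ (n div 2) * f $ (n div 2) else 0)"
  for f :: "real fps"
proof -
  have "f oo (fps_const 4 * fps_X\<^sup>2) = f oo ((fps_const 4 * fps_X) oo (fps_X\<^sup>2))"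
    by (simp add: fps_compose_mult_distrib)
  also have "\<dots> = (f oo (fps_const 4 * fps_X)) oo (fps_X\<^sup>2)"
    by (rule fps_compose_assoc) auto
  finally show ?thesis by (simp add: fps_nth_compose_X_power)
qed

section \<open>Half-integer binomial coefficients\<close>

lemma pochhammer_half: "pochhammer (1 / 2) n = fact (2 * n) / (4 ^ n * fact n :: real)"
  using fact_double[of n, where ?'a = real] by (simp add: power_mult)

text \<open>The numerator of the binomial consists of the last m factors of
  \<open>pochhammer (1 / 2) N\<close>, hence is a quotient of two such symbols at 1/2.\<close>

lemma gbinomial_half:
  assumes "m \<le> N"
  shows "(real N - 1 / 2) gchoose m =
    fact (2 * N) * fact (N - m) / (4 ^ m * fact N * fact (2 * (N - m)) * fact m)"
proof -
  define k where "k = N - m"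
  have N: "N = k + m" using assms by (simp add: k_def)
  have e: "real N - 1 / 2 - real m + 1 = 1 / 2 + real k" by (simp add: N)
  have "pochhammer (1 / 2) N = pochhammer (1 / 2 :: real) k * pochhammer (1 / 2 + real k) m"
    unfolding N by (rule pochhammer_product')
  then have p: "fact (2 * N) / (4 ^ N * fact N) =
      fact (2 * k) / (4 ^ k * fact k) * pochhammer (1 / 2 + real k) m"
    by (simp only: pochhammer_half)
  have "(real N - 1 / 2) gchoose m = pochhammer (1 / 2 + real k) m / fact m"
    unfolding gbinomial_pochhammer' e ..
  also have "pochhammer (1 / 2 + real k) m =
      fact (2 * N) / (4 ^ N * fact N) * (4 ^ k * fact k) / fact (2 * k)"
    unfolding p by simp
  also have "(4::real) ^ N = 4 ^ k * 4 ^ m" by (simp add: N power_add)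
  finally show ?thesis by (simp add: k_def[symmetric])
qed

subsection \<open>Catalan series\<close>

text \<open>In terms of r = (1 - 4x)^(1/2) and s = (1 + 4x)^(1/2) one has c = ((1 + r)/2)^2, d = ((1
  + s)/2)^2 and w = 2/(r + s). The relations are consequences of this with denominators
  cleared.\<close>

lemma catalan_pair_relations:
  fixes x g e w :: "'a :: idom"
  assumes g: "g = x * (1 + g)\<^sup>2" and e: "e = - x * (1 + e)\<^sup>2"
    and w: "2 * w = 2 + g + e" and x: "x \<noteq> 0" and two: "(2 :: 'a) \<noteq> 0"
  defines "c \<equiv> 1 - 2 * x - x * g" and "d \<equiv> 1 + 2 * x + x * e"
  shows "c\<^sup>2 + x\<^sup>2 = (1 - 2 * x) * c" and "d\<^sup>2 + x\<^sup>2 = (1 + 2 * x) * d"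
    and "w * (c + d) = 1 + w" and "4 * w ^ 4 * (c * d) = (1 + w)\<^sup>2" and "4 * x\<^sup>2 * w ^ 4 = w\<^sup>2 - 1"
proof -
  have "(4 :: 'a) = 2 * 2" by simp
  then have four: "(4 :: 'a) \<noteq> 0" using two by (metis no_zero_divisors)
  define r s where "r = 1 - 2 * x - 2 * x * g" and "s = 1 + 2 * x + 2 * x * e"
  have r2: "r\<^sup>2 = 1 - 4 * x" using g unfolding r_def by algebra
  have s2: "s\<^sup>2 = 1 + 4 * x" using e unfolding s_def by algebra
  have sr: "4 * x * w = s - r" using w unfolding r_def s_def by algebra
  have c: "2 * c = 1 - 2 * x + r" and d: "2 * d = 1 + 2 * x + s"
    by (simp_all add: c_def d_def r_def s_def)
  show "c\<^sup>2 + x\<^sup>2 = (1 - 2 * x) * c" using g unfolding c_def by algebra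
  show "d\<^sup>2 + x\<^sup>2 = (1 + 2 * x) * d" using e unfolding d_def by algebra
  \<comment> \<open>Both sides equal s^2 - r^2.\<close>
  have "(4 * x) * (w * (r + s)) = (4 * x) * 2"
    using r2 s2 sr by algebra
  then have wrs: "w * (r + s) = 2" using x four by (metis mult_left_cancel no_zero_divisors)
  have "2 * (w * (c + d)) = w * (2 * c + 2 * d)" by (simp add: algebra_simps)
  also have "\<dots> = 2 * w + w * (r + s)" unfolding c d by (simp add: algebra_simps)
  finally have "2 * (w * (c + d)) = 2 * (1 + w)" unfolding wrs by simp
  then show "w * (c + d) = 1 + w" using two by (metis mult_left_cancel)
  have "2 * 2 = (w * (r + s))\<^sup>2" unfolding wrs by simp
  also have "\<dots> = w\<^sup>2 * (r\<^sup>2 + s\<^sup>2 + 2 * (r * s))"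
    by (simp add: power2_eq_square algebra_simps)
  also have "\<dots> = 2 * (w\<^sup>2 * (1 + r * s))" unfolding r2 s2 by (simp add: algebra_simps)
  finally have wrs2: "w\<^sup>2 * (1 + r * s) = 2" using two by (metis mult_left_cancel)
  have "4 * (4 * x\<^sup>2 * w ^ 4) = w\<^sup>2 * (4 * x * w)\<^sup>2"
    by (simp add: power_mult_distrib power2_eq_square power4_eq_xxxx)
  also have "\<dots> = w\<^sup>2 * (r\<^sup>2 + s\<^sup>2 - 2 * (r * s))"
    unfolding sr by (simp add: power2_eq_square algebra_simps)
  also have "\<dots> = 4 * w\<^sup>2 - 2 * (w\<^sup>2 * (1 + r * s))"
    unfolding r2 s2 by (simp add: algebra_simps)
  also have "\<dots> = 4 * (w\<^sup>2 - 1)" unfolding wrs2 by simp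
  finally show "4 * x\<^sup>2 * w ^ 4 = w\<^sup>2 - 1" using four by (metis mult_left_cancel)
  have "4 * c = 2 * (2 * c)" "4 * d = 2 * (2 * d)" by simp_all
  then have c': "4 * c = (1 + r)\<^sup>2" and d': "4 * d = (1 + s)\<^sup>2"
    unfolding c d power2_sum r2 s2 by simp_all
  have "w\<^sup>2 * ((1 + r) * (1 + s)) = w\<^sup>2 * (1 + r * s) + w * (w * (r + s))"
    by (simp add: power2_eq_square algebra_simps)
  then have wrs3: "w\<^sup>2 * ((1 + r) * (1 + s)) = 2 * (1 + w)"
    unfolding wrs2 wrs by simp
  have "4 * (4 * w ^ 4 * (c * d)) = w ^ 4 * ((4 * c) * (4 * d))" by simp
  also have "\<dots> = (w\<^sup>2 * ((1 + r) * (1 + s)))\<^sup>2"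
    unfolding c' d' by (simp add: power_mult_distrib)
  also have "\<dots> = 4 * (1 + w)\<^sup>2" unfolding wrs3 power_mult_distrib by simp
  finally show "4 * w ^ 4 * (c * d) = (1 + w)\<^sup>2" using four by (metis mult_left_cancel)
qed

text \<open>Here \<open>zi\<close> is 1/z, and \<open>P\<close>, \<open>N\<close> stand for (1 - G
  z)^(-1/2) and (1 - G/z)^(-1/2). After multiplication by w^4, the relation \<open>PNR\<close>
  replaces P^2, N^2 and P N by expressions in w, z and R, so that both sides can be compared as
  polynomials in R.\<close>

lemma diagonal_square_identity:
  fixes x z zi P N w c d R :: "'a :: idom"
  assumes z: "z * zi = 1"
    and P: "P\<^sup>2 * (1 - (w\<^sup>2 - 1) * z) = 1" and N: "N\<^sup>2 * (1 - (w\<^sup>2 - 1) * zi) = 1"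
    and R: "R\<^sup>2 = 1 - 4 * x\<^sup>2 * (z + 2 + zi)" and PNR: "w\<^sup>2 * P * N * R = 1"
    and cd: "w * (c + d) = 1 + w" "4 * w ^ 4 * (c * d) = (1 + w)\<^sup>2" and x: "4 * x\<^sup>2 * w ^ 4 = w\<^sup>2 - 1"
  shows "R\<^sup>2 * ((1 + z) * P + w * (z * P + N))\<^sup>2 =
    (2 * (1 + z) * c - (1 - R)) * (2 * (1 + z) * d - (1 - R))"
proof -
  define G where "G = w\<^sup>2 - 1"
  define e where "e = 1 + z + w * z"
  have RP: "w ^ 4 * R\<^sup>2 * P\<^sup>2 = 1 - G * zi"
    using PNR N unfolding G_def by algebra
  have RN: "w ^ 4 * R\<^sup>2 * N\<^sup>2 = 1 - G * z"
    using PNR P unfolding G_def by algebra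
  have "w ^ 4 * (R\<^sup>2 * ((1 + z) * P + w * (z * P + N))\<^sup>2) =
      e\<^sup>2 * (w ^ 4 * R\<^sup>2 * P\<^sup>2) + w\<^sup>2 * (w ^ 4 * R\<^sup>2 * N\<^sup>2) + 2 * e * w ^ 3 * R * (w\<^sup>2 * P * N * R)"
    unfolding e_def by algebra
  also have "\<dots> = e\<^sup>2 * (1 - G * zi) + w\<^sup>2 * (1 - G * z) + 2 * e * w ^ 3 * R"
    unfolding RP RN PNR by simp
  also have "\<dots> = (1 + z)\<^sup>2 * (1 + w)\<^sup>2 - 2 * (1 + z) * (1 - R) * (w ^ 3 * (1 + w)) +
      (w ^ 4 - 2 * w ^ 4 * R + (w ^ 4 - (w\<^sup>2 - 1) * (z + 2 + zi)))"
    using z unfolding e_def G_def by algebra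
  also have "w ^ 4 - (w\<^sup>2 - 1) * (z + 2 + zi) = w ^ 4 * R\<^sup>2"
    using R x by algebra
  also have "(1 + z)\<^sup>2 * (1 + w)\<^sup>2 - 2 * (1 + z) * (1 - R) * (w ^ 3 * (1 + w)) +
      (w ^ 4 - 2 * w ^ 4 * R + w ^ 4 * R\<^sup>2) =
      w ^ 4 * ((2 * (1 + z) * c - (1 - R)) * (2 * (1 + z) * d - (1 - R)))"
    using cd by algebra
  finally show ?thesis using PNR by auto
qed

definition cat_alt :: "real fps" where
  "cat_alt = cat_fps oo (- fps_X)"

lemma cat_alt_eq: "cat_alt = - fps_X * (1 + cat_alt)\<^sup>2"
proof -
  have "cat_fps oo (- fps_X) = (fps_X * (1 + cat_fps)\<^sup>2) oo (- fps_X)"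
    by (rule arg_cong[OF cat_fps_eq])
  also have "\<dots> = - fps_X * (1 + cat_alt)\<^sup>2"
    unfolding cat_alt_def power2_eq_square
    by (simp add: fps_compose_mult_distrib fps_compose_add_distrib del: mult_minus_left)
  finally show ?thesis unfolding cat_alt_def .
qed

text \<open>The series w, introduced as the even part of 1 + C. That w^2 - 1 satisfies the equation
  of G is the last of the \<open>root_relations\<close>.\<close>

definition cat_even :: "real fps" where
  "cat_even = 1 + fps_const (1 / 2) * (cat_fps + cat_alt)"

text \<open>The series c and d. Of the two roots of c^2 - (1 - 2t) c + t^2 this is the one with
  constant term 1; likewise \<open>root_plus\<close> with 1 + 2t.\<close>

definition root_minus :: "real fps" where "root_minus = 1 - 2 * fps_X - fps_X * cat_fps"
definition root_plus :: "real fps" where "root_plus = 1 + 2 * fps_X + fps_X * cat_alt"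

lemma two_cat_even: "2 * cat_even = 2 + cat_fps + cat_alt"
proof -
  have "(2 :: real fps) * fps_const (1 / 2) = 1"
    by (simp add: numeral_fps_const)
  then have "2 * (fps_const (1 / 2) * (cat_fps + cat_alt)) = cat_fps + cat_alt"
    by (simp only: mult.assoc[symmetric] mult_1)
  then show ?thesis unfolding cat_even_def by (simp add: distrib_left add.assoc)
qed

lemma fps_two_neq_0: "(2 :: real fps) \<noteq> 0"
  by (simp add: numeral_fps_const)

lemmas root_relations = catalan_pair_relations[OF cat_fps_eq cat_alt_eq two_cat_even fps_X_neq_zero fps_two_neq_0,
  folded root_minus_def root_plus_def]

lemma cat_fps_0: "cat_fps $ 0 = 0"
  using ballot_0_right(1)[of 0 0] by (simp add: cat_fps_def ballot_fps_def)

lemma cat_even_0: "cat_even $ 0 = 1"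
  by (simp add: cat_even_def cat_alt_def cat_fps_0)

text \<open>This serves to identify w with (1 + C(4t^2))^(1/2): the left side is the coefficient of
  t^(2m) in the latter, the right side that in C(t). At m = 0 they differ by the constant 1 that
  \<open>cat_even\<close> adds.\<close>

lemma ballot_central:
  assumes m: "m \<ge> 1"
  shows "4 ^ m * ballot (1 / 2) 0 m = ballot 0 1 (2 * m)"
proof -
  obtain k where k: "m = Suc k" using m by (cases m) auto
  have n: "2 * m - 1 = Suc (2 * k)" using k by simp
  have "ballot (1 / 2) 0 m = (1 / 2) / (2 * real m + 1 / 2) * ((2 * real m + 1 / 2) gchoose m)"
    using ballot_eq[of 0 m "1 / 2"] m by simp
  also have "(2 * real m + 1 / 2) gchoose m = (2 * real m + 1 / 2) / real m * ((2 * real m - 1 / 2) gchoose k)"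
    using gbinomial_absorption[of k "2 * real m + 1 / 2"] unfolding k by (simp add: field_simps)
  also have "(1 / 2) / (2 * real m + 1 / 2) * \<dots> = ((2 * real m - 1 / 2) gchoose k) / (2 * real m)"
    by (simp add: divide_simps)
  also have "(2 * real m - 1 / 2) gchoose k =
      fact (4 * m) * fact (m + 1) / (4 ^ k * fact (2 * m) * fact (2 * m + 2) * fact k)"
  proof -
    have "real (2 * m) = 2 * real m" "2 * (2 * m) = 4 * m" "2 * m - k = m + 1" "2 * (m + 1) = 2 * m + 2"
      "k \<le> 2 * m" using k by simp_all
    then show ?thesis using gbinomial_half[of k "2 * m"] by (simp only:)
  qed
  finally have "ballot (1 / 2) 0 m = fact (4 * m) * fact (m + 1) / (4 ^ k * fact (2 * m) * fact (2 * m + 2) * fact k) / (2 * real m)" .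
  then have L: "4 ^ m * ballot (1 / 2) 0 m = 4 * (fact (4 * m) * fact (m + 1) / (fact (2 * m) * fact (2 * m + 2) * fact k)) / (2 * real m)"
    by (simp add: k del: fact_Suc)
  have "ballot 0 1 (2 * m) = 2 / real (4 * m) * (real (4 * m) gchoose (2 * m - 1))"
    using ballot_eq[of 1 "2 * m" 0] m by simp
  also have "real (4 * m) gchoose (2 * m - 1) = fact (4 * m) / (fact (2 * m - 1) * fact (2 * m + 1))"
  proof -
    have "4 * m - (2 * m - 1) = 2 * m + 1" using m by simp
    then show ?thesis unfolding binomial_gbinomial[symmetric]
      by (subst binomial_fact) auto
  qed
  finally have Rr: "ballot 0 1 (2 * m) = 2 / real (4 * m) * (fact (4 * m) / (fact (2 * m - 1) * fact (2 * m + 1)))" .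
  have f: "fact (m + 1) = real (m + 1) * (real m * fact k)"
    "fact (2 * m) = 2 * real m * (fact (2 * m - 1) :: real)"
    "fact (2 * m + 2) = 2 * real (m + 1) * (fact (2 * m + 1) :: real)"
    using fact_Suc[of m, where ?'a = real] fact_Suc[of k, where ?'a = real]
      fact_Suc[of "2 * m - 1", where ?'a = real] fact_Suc[of "2 * m + 1", where ?'a = real] k
    by (simp_all del: fact_Suc add: k n)
  \<comment> \<open>With the factorials as positive unknowns and u = m, a rational identity
    remains.\<close>
  have gen: "4 * (F * ((u + 1) * (u * K)) / ((2 * u * A) * (2 * (u + 1) * B) * K)) / (2 * u) =
      2 / (4 * u) * (F / (A * B))"
    if "u > 0" "K > 0" "A > 0" "B > 0" for F K A B u :: real
    using that by (simp add: divide_simps)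
  have e: "real (m + 1) = real m + 1" "real (4 * m) = 4 * real m" by simp_all
  show ?thesis unfolding L Rr f e by (rule gen) (use m in auto)
qed

abbreviation four_X2 :: "real fps" where "four_X2 \<equiv> fps_const 4 * fps_X\<^sup>2"

lemma cat_even_altdef: "cat_even = ballot_fps (1 / 2) 0 oo four_X2"
proof (rule fps_ext)
  fix n
  have "cat_even $ n = (if n = 0 then 1 else (1 + (-1) ^ n) / 2 * ballot 0 1 n)"
    using ballot_0_right(1)[of 0 0]
    by (simp add: cat_even_def cat_alt_def cat_fps_def ballot_fps_def fps_compose_uminus' field_simps)
  also have "\<dots> = (ballot_fps (1 / 2) 0 oo four_X2) $ n"
    using ballot_central[of "n div 2"]
    by (auto simp: fps_compose_4X2_nth ballot_fps_def ballot_0_right elim!: evenE)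
  finally show "cat_even $ n = (ballot_fps (1 / 2) 0 oo four_X2) $ n" .
qed

text \<open>G = w^2 - 1 is the ratio belonging to the recurrence that the ballot series satisfy once
  t is replaced by 4t^2. For a = 0 and a = 1/2 this yields the coefficients of G^i and w
  G^i.\<close>

lemma ballot_compose_4X2:
  "ballot_fps a i oo four_X2 = (cat_even\<^sup>2 - 1) ^ i * (ballot_fps a 0 oo four_X2)"
proof -
  \<comment> \<open>One factor of t^2 stays in front for the contraction; the other goes into the
    coefficients.\<close>
  have Y: "cat_even\<^sup>2 - 1 = fps_X * (fps_X * 4 + fps_X * 8 * (cat_even\<^sup>2 - 1) + fps_X * 4 * (cat_even\<^sup>2 - 1)\<^sup>2)"
    using root_relations(5) by algebra
  show ?thesis
  proof (rule fps_recurrence_geometric[OF Y, where C = "\<lambda>i. ballot_fps a i oo four_X2"])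
    fix j
    let ?b = "\<lambda>i. ballot_fps a i oo four_X2"
    have e: "four_X2 = fps_X * (fps_X * 4)"
      by (simp add: numeral_fps_const power2_eq_square mult_ac)
    have dist: "x * (x * 4) * (p + 2 * q + r) = x * (x * 4 * p + x * 8 * q + x * 4 * r)"
      for x p q r :: "real fps" by algebra
    have "?b (Suc j) = (fps_X * (1 * ballot_fps a j + 2 * ballot_fps a (Suc j) + 1 * ballot_fps a (Suc (Suc j)))) oo four_X2"
      by (rule arg_cong[OF ballot_fps_Suc])
    also have "\<dots> = four_X2 * (?b j + 2 * ?b (Suc j) + ?b (Suc (Suc j)))"
      by (simp add: fps_compose_mult_distrib fps_compose_add_distrib)
    also have "\<dots> = fps_X * (fps_X * 4 * ?b j + fps_X * 8 * ?b (Suc j) + fps_X * 4 * ?b (Suc (Suc j)))"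
      unfolding e by (rule dist)
    finally show "?b (Suc j) = fps_X * (fps_X * 4 * ?b j + fps_X * 8 * ?b (Suc j) + fps_X * 4 * ?b (Suc (Suc j)))" .
  qed
qed

subsection \<open>Kernel equations\<close>

text \<open>Splitting a \<open>Sum_any\<close> requires finite supports. An injective
  \<open>l\<close> and an arbitrary \<open>m\<close> cover rows and diagonals alike.\<close>

lemma walks_finite_support:
  assumes "inj l"
  shows "finite {i. walks (l i) (m i) n * g i \<noteq> 0}"
proof -
  have "{i. walks (l i) (m i) n * g i \<noteq> 0} \<subseteq> l -` {- int n..int n}"
    using walks_eq_0[of n] by (force simp: not_less)
  then show ?thesis
    by (rule finite_subset) (intro finite_vimageI assms finite_atLeastAtMost_int)
qed

lemma inflow_finite_support: "inj l \<Longrightarrow> finite {i. inflow (l i) (m i) n * g i \<noteq> 0}"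
proof -
  assume l: "inj l"
  have "finite {i. walks (l i - 1) (m i) n * g i \<noteq> 0}" "finite {i. walks (l i + 1) (m i) n * g i \<noteq> 0}"
    "finite {i. walks (l i) (m i - 1) n * g i \<noteq> 0}" "finite {i. walks (l i) (m i + 1) n * g i \<noteq> 0}"
    by (rule walks_finite_support, use l in \<open>simp add: inj_def\<close>)+
  moreover have "{i. inflow (l i) (m i) n * g i \<noteq> 0} \<subseteq>
    {i. walks (l i - 1) (m i) n * g i \<noteq> 0} \<union> {i. walks (l i + 1) (m i) n * g i \<noteq> 0} \<union>
    {i. walks (l i) (m i - 1) n * g i \<noteq> 0} \<union> {i. walks (l i) (m i + 1) n * g i \<noteq> 0}"
    by (auto simp: inflow_def)
  ultimately show ?thesis by (meson finite_UnI finite_subset)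
qed

lemma Sum_any_inflow:
  fixes l m :: "'a \<Rightarrow> int"
  assumes "inj l"
  shows "(Sum_any (\<lambda>i. inflow (l i) (m i) n * g i)) =
    (Sum_any (\<lambda>i. walks (l i - 1) (m i) n * g i)) + (Sum_any (\<lambda>i. walks (l i + 1) (m i) n * g i)) +
    (Sum_any (\<lambda>i. walks (l i) (m i - 1) n * g i)) + (Sum_any (\<lambda>i. walks (l i) (m i + 1) n * g i))"
proof -
  have fin: "finite {i. walks (l i - 1) (m i) n * g i \<noteq> 0}" "finite {i. walks (l i + 1) (m i) n * g i \<noteq> 0}"
    "finite {i. walks (l i) (m i - 1) n * g i \<noteq> 0}" "finite {i. walks (l i) (m i + 1) n * g i \<noteq> 0}"
    by (rule walks_finite_support, use assms in \<open>simp add: inj_def\<close>)+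
  have fin2: "finite {i. f i + h i \<noteq> 0}" if "finite {i. f i \<noteq> 0}" "finite {i. h i \<noteq> 0}" for f h :: "'a \<Rightarrow> real"
    by (rule finite_subset[OF _ finite_UnI[OF that]]) auto
  show ?thesis
    unfolding inflow_def distrib_right
    by (simp only: Sum_any.distrib fin fin2)
qed

lemma Sum_any_scale_shift:
  fixes F g :: "int \<Rightarrow> real"
  assumes "finite {i. F i * g i \<noteq> 0}" "\<And>i. g (i + s) = c * g i"
  shows "(Sum_any (\<lambda>i. F (i - s) * g i)) = c * (Sum_any (\<lambda>i. F i * g i))"
proof -
  have "(Sum_any (\<lambda>i. F (i - s) * g i)) = (Sum_any (\<lambda>i. c * (F i * g i)))"
  proof (rule Sum_any.reindex_cong)
    show "bij (\<lambda>i. i + s)" by (rule bij_betw_byWitness[where f' = "\<lambda>i. i - s"]) auto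
    show "(\<lambda>i. F (i - s) * g i) \<circ> (\<lambda>i. i + s) = (\<lambda>i. c * (F i * g i))"
      by (auto simp: assms(2))
  qed
  then show ?thesis using assms(1) by (simp add: Sum_any_right_distrib)
qed

text \<open>\<open>hits k n\<close> counts the walks of length \<open>n\<close> that return to the slit for the first time at
  their end \<open>(-k, 0)\<close>; \<open>y\<close> in \<open>slit_fps\<close> stands for \<open>1/x\<close>.\<close>

definition hits :: "nat \<Rightarrow> nat \<Rightarrow> real" where
  "hits k n = (case n of 0 \<Rightarrow> 0 | Suc m \<Rightarrow> inflow (- int k) 0 m)"

definition slit_coeff :: "nat \<Rightarrow> real fps" where
  "slit_coeff k = Abs_fps (\<lambda>n. (if k = 0 \<and> n = 0 then 1 else 0) - hits k n)"

definition slit_fps :: "real \<Rightarrow> real fps" where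
  "slit_fps y = Abs_fps (\<lambda>n. \<Sum>k\<le>n. slit_coeff k $ n * y ^ k)"

lemma slit_coeff_eq_0: "n < k \<Longrightarrow> slit_coeff k $ n = 0"
  by (cases n) (simp_all add: slit_coeff_def hits_def inflow_def walks_eq_0)

definition row_fps :: "real \<Rightarrow> int \<Rightarrow> real fps" where
  "row_fps x j = Abs_fps (\<lambda>n. Sum_any (\<lambda>i. walks i j n * x powi i))"

text \<open>The vertex (i, i - j) weighs p to the sum of its coordinates: steps right and up weigh
  p, steps left and down 1/p. Either neighbouring diagonal is thus reached with the same total
  weight p + 1/p, and on j = 0 the weight is z^i with z = p^2.\<close>

definition diag_fps :: "real \<Rightarrow> int \<Rightarrow> real fps" where
  "diag_fps p j = Abs_fps (\<lambda>n. Sum_any (\<lambda>i. walks i (i - j) n * p powi (2 * i - j)))"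

lemma Sum_any_walks_Suc:
  assumes "inj l"
  shows "(Sum_any (\<lambda>i. walks (l i) (m i) (Suc n) * g i)) =
    (Sum_any (\<lambda>i. inflow (l i) (m i) n * g i)) - (Sum_any (\<lambda>i. inflow (l i) (m i) n * (if (l i, m i) \<in> slit then g i else 0)))"
proof -
  have "(Sum_any (\<lambda>i. inflow (l i) (m i) n * g i)) =
      (Sum_any (\<lambda>i. walks (l i) (m i) (Suc n) * g i + inflow (l i) (m i) n * (if (l i, m i) \<in> slit then g i else 0)))"
    by (rule Sum_any.cong) (simp add: walks_Suc)
  also have "\<dots> = (Sum_any (\<lambda>i. walks (l i) (m i) (Suc n) * g i)) +
      (Sum_any (\<lambda>i. inflow (l i) (m i) n * (if (l i, m i) \<in> slit then g i else 0)))"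
    by (intro Sum_any.distrib walks_finite_support inflow_finite_support assms)
  finally show ?thesis by simp
qed

text \<open>Decomposition by the last step. The slit lies in the row j = 0, so
  \<open>slit_fps\<close>, which carries the starting point as 1 and arrivals on the slit with a
  minus sign, occurs there only.\<close>

lemma row_fps_eq:
  assumes x: "x \<noteq> 0"
  shows "row_fps x j = (if j = 0 then slit_fps (1 / x) else 0) +
    fps_X * (fps_const (x + 1 / x) * row_fps x j + row_fps x (j - 1) + row_fps x (j + 1))"
proof (rule fps_ext)
  fix n
  show "row_fps x j $ n = ((if j = 0 then slit_fps (1 / x) else 0) +
    fps_X * (fps_const (x + 1 / x) * row_fps x j + row_fps x (j - 1) + row_fps x (j + 1))) $ n"
  proof (cases n)
    case 0
    have "(Sum_any (\<lambda>i. walks i j 0 * x powi i)) = (Sum_any (\<lambda>i::int. if i = 0 then (if j = 0 then 1 else 0) else 0))"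
      by (rule Sum_any.cong) (simp add: walks_0)
    also have "\<dots> = (if j = 0 then 1 else 0)" by (rule Sum_any.delta)
    finally show ?thesis using 0
      by (simp add: row_fps_def slit_fps_def slit_coeff_def hits_def)
  next
    case (Suc m)
    have fin: "finite {i. walks i j m * x powi i \<noteq> 0}" for j
      by (rule walks_finite_support) simp
    have r: "(Sum_any (\<lambda>i. walks (i - 1) j m * x powi i)) = x * (Sum_any (\<lambda>i. walks i j m * x powi i))"
      by (rule Sum_any_scale_shift[OF fin]) (simp add: power_int_add x)
    have l: "(Sum_any (\<lambda>i. walks (i + 1) j m * x powi i)) = 1 / x * (Sum_any (\<lambda>i. walks i j m * x powi i))"
      using Sum_any_scale_shift[OF fin[of j], of "- 1" "1 / x"] by (simp add: power_int_diff x)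
    have s: "(Sum_any (\<lambda>i. inflow i j m * (if (i, j) \<in> slit then x powi i else 0))) =
        - (if j = 0 then slit_fps (1 / x) else 0) $ Suc m"
    proof (cases "j = 0")
      case False
      then show ?thesis by (simp add: mem_slit)
    next
      case True
      have "{i. inflow i 0 m * (if (i, 0) \<in> slit then x powi i else 0) \<noteq> 0} \<subseteq> (\<lambda>k. - int k) ` {..Suc m}"
      proof safe
        fix i assume i: "inflow i 0 m * (if (i, 0) \<in> slit then x powi i else 0) \<noteq> 0"
        then have "i \<le> 0" by (auto simp: mem_slit split: if_splits)
        moreover have "\<bar>i\<bar> \<le> int (Suc m)"
        proof (rule ccontr)
          assume "\<not> \<bar>i\<bar> \<le> int (Suc m)"
          then have "inflow i 0 m = 0" by (simp add: inflow_def walks_eq_0)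
          then show False using i by simp
        qed
        ultimately show "i \<in> (\<lambda>k. - int k) ` {..Suc m}"
          by (intro image_eqI[where x = "nat (- i)"]) auto
      qed
      then have "(Sum_any (\<lambda>i. inflow i 0 m * (if (i, 0) \<in> slit then x powi i else 0))) =
          (\<Sum>i\<in>(\<lambda>k. - int k) ` {..Suc m}. inflow i 0 m * (if (i, 0) \<in> slit then x powi i else 0))"
        by (intro Sum_any.expand_superset) auto
      also have "\<dots> = (\<Sum>k\<le>Suc m. inflow (- int k) 0 m * (1 / x) ^ k)"
        by (subst sum.reindex) (auto simp: inj_on_def mem_slit power_int_minus inverse_eq_divide power_one_over intro!: sum.cong)
      also have "\<dots> = - slit_fps (1 / x) $ Suc m"
        by (simp add: slit_fps_def slit_coeff_def hits_def sum_negf del: sum.atMost_Suc)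
      finally show ?thesis using True by simp
    qed
    show ?thesis
      unfolding Suc using Sum_any_walks_Suc[of "\<lambda>i. i" "\<lambda>_. j" m "\<lambda>i. x powi i"]
        Sum_any_inflow[of "\<lambda>i. i" "\<lambda>_. j" m "\<lambda>i. x powi i"]
      by (simp add: row_fps_def r l s) (simp add: algebra_simps)
  qed
qed

text \<open>The diagonal x - y = j meets the slit only if j <= 0, and then in the single point (j,
  0) of weight p^j. So one coefficient of S enters instead of the whole series.\<close>

lemma diag_fps_eq:
  assumes p: "p \<noteq> 0"
  shows "diag_fps p j = (if j \<le> 0 then fps_const (p powi j) * slit_coeff (nat (- j)) else 0) +
    fps_X * (fps_const (p + 1 / p) * (diag_fps p (j - 1) + diag_fps p (j + 1)))"
proof (rule fps_ext)
  fix n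
  show "diag_fps p j $ n = ((if j \<le> 0 then fps_const (p powi j) * slit_coeff (nat (- j)) else 0) +
    fps_X * (fps_const (p + 1 / p) * (diag_fps p (j - 1) + diag_fps p (j + 1)))) $ n"
  proof (cases n)
    case 0
    have "(Sum_any (\<lambda>i. walks i (i - j) 0 * p powi (2 * i - j))) = (Sum_any (\<lambda>i::int. if i = 0 then (if j = 0 then 1 else 0) else 0))"
      by (rule Sum_any.cong) (auto simp: walks_0)
    also have "\<dots> = (if j = 0 then 1 else 0)" by (rule Sum_any.delta)
    finally show ?thesis using 0
      by (auto simp: diag_fps_def slit_coeff_def hits_def)
  next
    case (Suc m)
    let ?D = "\<lambda>j. Sum_any (\<lambda>i. walks i (i - j) m * p powi (2 * i - j))"
    have fin: "finite {i. walks i (i - j) m * g i \<noteq> 0}" for j g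
      by (rule walks_finite_support) simp
    have scale: "(Sum_any (\<lambda>i. walks i (i - j') m * p powi (2 * i - j))) = p powi (j' - j) * ?D j'" for j'
    proof -
      have "p powi (2 * i - j) = p powi (j' - j) * p powi (2 * i - j')" for i
        using p by (simp flip: power_int_add)
      then have "(Sum_any (\<lambda>i. walks i (i - j') m * p powi (2 * i - j))) =
          (Sum_any (\<lambda>i. p powi (j' - j) * (walks i (i - j') m * p powi (2 * i - j'))))"
        by (intro Sum_any.cong) simp
      then show ?thesis by (simp only: Sum_any_right_distrib[OF fin])
    qed
    have shift: "(Sum_any (\<lambda>i. walks (i - s) (i - s - j') m * p powi (2 * i - j))) =
        p powi (2 * s + j' - j) * ?D j'" for s j'
    proof -
      have "(Sum_any (\<lambda>i. walks (i - s) (i - s - j') m * p powi (2 * i - j))) =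
          p powi (2 * s) * (Sum_any (\<lambda>i. walks i (i - j') m * p powi (2 * i - j)))"
        by (rule Sum_any_scale_shift[where F = "\<lambda>i. walks i (i - j') m", OF fin])
          (use p in \<open>simp add: power_int_add[symmetric] algebra_simps\<close>)
      moreover have "p powi (2 * s + j' - j) = p powi (2 * s) * p powi (j' - j)"
        using p by (simp add: power_int_add[symmetric] add_diff_eq)
      ultimately show ?thesis by (simp only: scale mult.assoc)
    qed
    have r: "(Sum_any (\<lambda>i. walks (i - 1) (i - j) m * p powi (2 * i - j))) = p * ?D (j - 1)"
      using shift[of 1 "j - 1"] by simp
    have l: "(Sum_any (\<lambda>i. walks (i + 1) (i - j) m * p powi (2 * i - j))) = 1 / p * ?D (j + 1)"
      using shift[of "- 1" "j + 1"] by (simp add: power_int_minus inverse_eq_divide)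
    have d: "(Sum_any (\<lambda>i. walks i (i - j - 1) m * p powi (2 * i - j))) = p * ?D (j + 1)"
      using scale[of "j + 1"] by (simp add: diff_diff_eq)
    have u: "(Sum_any (\<lambda>i. walks i (i - j + 1) m * p powi (2 * i - j))) = 1 / p * ?D (j - 1)"
      using scale[of "j - 1"] by (simp add: power_int_minus inverse_eq_divide algebra_simps)
    have s: "(Sum_any (\<lambda>i. inflow i (i - j) m * (if (i, i - j) \<in> slit then p powi (2 * i - j) else 0))) =
        - (if j \<le> 0 then fps_const (p powi j) * slit_coeff (nat (- j)) else 0) $ Suc m"
    proof -
      have "(Sum_any (\<lambda>i. inflow i (i - j) m * (if (i, i - j) \<in> slit then p powi (2 * i - j) else 0))) =
        (Sum_any (\<lambda>i. if i = j then (if j \<le> 0 then inflow j 0 m * p powi j else 0) else 0))"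
        by (rule Sum_any.cong) (auto simp: mem_slit)
      also have "\<dots> = (if j \<le> 0 then inflow j 0 m * p powi j else 0)" by (rule Sum_any.delta)
      finally show ?thesis by (simp add: slit_coeff_def hits_def)
    qed
    show ?thesis
      unfolding Suc using Sum_any_walks_Suc[of "\<lambda>i. i" "\<lambda>i. i - j" m "\<lambda>i. p powi (2 * i - j)"]
        Sum_any_inflow[of "\<lambda>i. i" "\<lambda>i. i - j" m "\<lambda>i. p powi (2 * i - j)"]
      by (simp add: diag_fps_def r l d u s) (simp add: algebra_simps)
  qed
qed

subsection \<open>Wiener-Hopf factorization\<close>

text \<open>An element of R[x][[t]], encoded by its specializations at real x.\<close>

definition poly_coeffs :: "(real \<Rightarrow> real fps) \<Rightarrow> bool" where
  "poly_coeffs F \<longleftrightarrow> (\<forall>n. \<exists>q. \<forall>x. F x $ n = poly q x)"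

lemma poly_fun_sum:
  assumes "\<And>i. i \<in> I \<Longrightarrow> \<exists>q. \<forall>x. f i x = poly q x"
  shows "\<exists>q. \<forall>x. (\<Sum>i\<in>I. f i x) = poly q (x :: real)"
proof -
  obtain q where "\<And>i x. i \<in> I \<Longrightarrow> f i x = poly (q i) x" using assms by metis
  then have "\<forall>x. (\<Sum>i\<in>I. f i x) = poly (\<Sum>i\<in>I. q i) x" by (simp add: poly_sum)
  then show ?thesis by blast
qed

lemma poly_fun_mult:
  assumes "\<exists>q. \<forall>x. f x = poly q x" "\<exists>q. \<forall>x. g x = poly q (x :: real)"
  shows "\<exists>q. \<forall>x. f x * g x = poly q x"
  using assms by (metis poly_mult)

lemma poly_coeffs_mult: "poly_coeffs F \<Longrightarrow> poly_coeffs G \<Longrightarrow> poly_coeffs (\<lambda>x. F x * G x)"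
  unfolding poly_coeffs_def fps_mult_nth by (intro allI poly_fun_sum poly_fun_mult) auto

lemma poly_coeffs_diff:
  assumes "poly_coeffs F" "poly_coeffs G"
  shows "poly_coeffs (\<lambda>x. F x - G x)"
  using assms unfolding poly_coeffs_def fps_sub_nth by (metis poly_diff)

lemma poly_coeffs_const: "poly_coeffs (\<lambda>_. F)"
  unfolding poly_coeffs_def by (metis poly_pCons poly_0 mult_zero_right add.right_neutral)

lemma poly_coeffs_fps_const: "poly_coeffs fps_const"
proof -
  have "fps_const x $ n = poly (if n = 0 then [:0, 1:] else 0) x" for n and x :: real
    by simp
  then show ?thesis unfolding poly_coeffs_def by blast
qed

lemma poly_coeffs_Abs_fps: "poly_coeffs (\<lambda>x. Abs_fps (\<lambda>n. \<Sum>k\<le>N n. a n k * x ^ k))"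
proof -
  have "\<exists>q. \<forall>x. (\<Sum>k\<le>N n. a n k * x ^ k) = poly q x" for n
    by (rule poly_fun_sum) (metis poly_monom)
  then show ?thesis by (simp add: poly_coeffs_def)
qed

text \<open>Multiplied by x^(degree q), the right side becomes the reflected polynomial, whose
  degree is at most that of \<open>q\<close>; this leaves degree 0 for \<open>p\<close>.\<close>

lemma poly_eq_poly_inverse_imp_const:
  fixes p q :: "real poly"
  assumes "\<And>x. x > 0 \<Longrightarrow> poly p x = poly q (1 / x)"
  shows "poly p x = poly p y"
proof -
  have "poly (p * monom 1 (degree q)) x = poly (reflect_poly q) x" if "x > 0" for x
    using assms[OF that] that by (simp add: poly_reflect_poly_nz poly_monom inverse_eq_divide)
  then have "{0<..} \<subseteq> {x. poly (p * monom 1 (degree q) - reflect_poly q) x = 0}" by auto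
  then have "p * monom 1 (degree q) - reflect_poly q = 0"
    using poly_roots_finite infinite_Ioi finite_subset by metis
  then have e: "p * monom 1 (degree q) = reflect_poly q" by simp
  have "degree p = 0"
  proof (cases "p = 0")
    case False
    then have "degree p + degree q = degree (reflect_poly q)"
      unfolding e[symmetric] by (simp add: degree_mult_eq degree_monom_eq monom_eq_0_iff)
    also have "\<dots> \<le> degree q" by (rule degree_reflect_poly_le)
    finally show ?thesis by simp
  qed simp
  then show ?thesis by (metis degree_eq_zeroE poly_pCons poly_0 mult_zero_right)
qed

text \<open>If \<open>L(x) M(1/x) = T(1/x)\<close>, then by induction on the order in \<open>t\<close> each coefficient of \<open>L\<close>
  is a polynomial both in \<open>x\<close> and in \<open>1/x\<close>.\<close>

lemma wiener_hopf_const: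
  assumes L: "poly_coeffs L" and M: "poly_coeffs M" and T: "poly_coeffs T"
    and M0: "\<And>y. M y $ 0 = 1"
    and eq: "\<And>x. x > 0 \<Longrightarrow> L x * M (1 / x) = T (1 / x)"
  shows "L x = L y"
proof (rule fps_ext)
  fix n show "L x $ n = L y $ n"
  proof (induction n arbitrary: x y rule: less_induct)
    case (less n)
    obtain p where p: "\<And>x. L x $ n = poly p x" using L by (auto simp: poly_coeffs_def)
    \<comment> \<open>By the induction hypothesis the lower coefficients of \<open>L\<close> are
      constant; their values at 0 make this sum a polynomial in the argument of \<open>M\<close>
      alone.\<close>
    have "\<exists>q. \<forall>y. (\<Sum>i<n. L 0 $ i * M y $ (n - i)) = poly q y"
      using M by (intro poly_fun_sum poly_fun_mult) (auto simp: poly_coeffs_def intro: exI[of _ "[:_:]"])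
    then obtain q1 where q1: "\<And>y. (\<Sum>i<n. L 0 $ i * M y $ (n - i)) = poly q1 y" by blast
    obtain q2 where q2: "\<And>y. T y $ n = poly q2 y" using T by (auto simp: poly_coeffs_def)
    have "poly p x = poly (q2 - q1) (1 / x)" if "x > 0" for x
    proof -
      have "poly q2 (1 / x) = (\<Sum>i\<le>n. L x $ i * M (1 / x) $ (n - i))"
        using arg_cong[OF eq[OF that], of "\<lambda>f. f $ n"] q2 by (simp add: fps_mult_nth atMost_atLeast0)
      also have "\<dots> = L x $ n + (\<Sum>i<n. L x $ i * M (1 / x) $ (n - i))"
        by (simp add: M0 lessThan_Suc_atMost[symmetric])
      also have "(\<Sum>i<n. L x $ i * M (1 / x) $ (n - i)) = (\<Sum>i<n. L 0 $ i * M (1 / x) $ (n - i))"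
        using less[of _ x 0] by (intro sum.cong) auto
      finally show ?thesis using p q1 by simp
    qed
    then show ?case unfolding p by (rule poly_eq_poly_inverse_imp_const)
  qed
qed

section \<open>The positive axis and the square of the slit series\<close>

lemma kernel_root_square:
  fixes x l Y :: "'a :: idom"
  assumes "Y = x * (1 + l * Y + 1 * Y\<^sup>2)"
  shows "(1 - x * l - 2 * x * Y)\<^sup>2 = (1 - x * l)\<^sup>2 - 4 * x\<^sup>2"
  using assms by algebra

text \<open>The row j = 0 with polynomial coefficients: no walk ends at a point (i, 0) with i <
  0.\<close>

definition axis_fps :: "real \<Rightarrow> real fps" where
  "axis_fps x = Abs_fps (\<lambda>n. \<Sum>k\<le>n. walks (int k) 0 n * x ^ k)"

lemma row_fps_0: "row_fps x 0 = axis_fps x" if "x \<noteq> 0"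
proof (rule fps_ext)
  fix n
  have neg: "walks i 0 n = 0" if "i < 0" for i
    using that by (cases n) (simp_all add: walks_0 walks_Suc mem_slit)
  have "{i. walks i 0 n * x powi i \<noteq> 0} \<subseteq> int ` {..n}"
  proof
    fix i assume "i \<in> {i. walks i 0 n * x powi i \<noteq> 0}"
    then have "i \<ge> 0" "i \<le> int n" using neg walks_eq_0[of n i 0] by force+
    then show "i \<in> int ` {..n}" by (intro image_eqI[where x = "nat i"]) auto
  qed
  then have "Sum_any (\<lambda>i. walks i 0 n * x powi i) = (\<Sum>i\<in>int ` {..n}. walks i 0 n * x powi i)"
    by (intro Sum_any.expand_superset) auto
  then show "row_fps x 0 $ n = axis_fps x $ n"
    by (simp add: row_fps_def axis_fps_def sum.reindex)
qed

text \<open>In the expansion c^2 + x^2 - x c (z + zi) the sum of squares is replaced by (1 - 2x) c.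
  Thus, up to the factors c and d, the kernel splits into a part in z and a part in 1/z.\<close>

lemma root_factorization:
  fixes c d x z zi l :: "'a :: idom"
  assumes "c\<^sup>2 + x\<^sup>2 = (1 - 2 * x) * c" "d\<^sup>2 + x\<^sup>2 = (1 + 2 * x) * d" "z * zi = 1" "l = z + zi"
  shows "(c - x * z) * (c - x * zi) = (1 - x * l - 2 * x) * c"
    "(d - x * z) * (d - x * zi) = (1 - x * l + 2 * x) * d"
  using assms by algebra+

text \<open>The rows above and below the axis both decay with ratio Y, so the equation of row 0
  becomes A (1 - t l - 2 t Y) = S, with A the axis series and l = x + 1/x. The bracket is a square
  root of the discriminant of the quadratic for Y; squaring removes Y.\<close>

lemma axis_kernel_equation:
  assumes x: "x \<noteq> 0"
  shows "(axis_fps x)\<^sup>2 * ((1 - fps_X * fps_const (x + 1 / x))\<^sup>2 - 4 * fps_X\<^sup>2) = (slit_fps (1 / x))\<^sup>2"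
proof -
  let ?l = "fps_const (x + 1 / x)"
  obtain Y :: "real fps" where Y: "Y = fps_X * (1 + ?l * Y + 1 * Y\<^sup>2)"
    by (rule fps_quadratic_fixpoint)
  have up: "row_fps x (int j) = Y ^ j * row_fps x 0" for j
  proof -
    have "row_fps x (int (Suc j)) = fps_X * (1 * row_fps x (int j) + ?l * row_fps x (int (Suc j)) + 1 * row_fps x (int (Suc (Suc j))))" for j
      by (subst row_fps_eq[OF x]) (simp add: add_ac)
    then show ?thesis
      using fps_recurrence_geometric[OF Y, of "\<lambda>j. row_fps x (int j)"] by simp
  qed
  have down: "row_fps x (- int j) = Y ^ j * row_fps x 0" for j
  proof -
    have "row_fps x (- int (Suc j)) = fps_X * (1 * row_fps x (- int j) + ?l * row_fps x (- int (Suc j)) + 1 * row_fps x (- int (Suc (Suc j))))" for j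
      by (subst row_fps_eq[OF x]) (simp add: add_ac)
    then show ?thesis
      using fps_recurrence_geometric[OF Y, of "\<lambda>j. row_fps x (- int j)"] by simp
  qed
  have "row_fps x 0 = slit_fps (1 / x) + fps_X * (?l * row_fps x 0 + row_fps x (- 1) + row_fps x 1)"
    by (subst row_fps_eq[OF x]) simp
  also have "row_fps x (- 1) = Y * row_fps x 0" using down[of 1] by simp
  also have "row_fps x 1 = Y * row_fps x 0" using up[of 1] by simp
  finally have "row_fps x 0 * (1 - fps_X * ?l - 2 * fps_X * Y) = slit_fps (1 / x)"
    by algebra
  then have "(slit_fps (1 / x))\<^sup>2 = (row_fps x 0)\<^sup>2 * (1 - fps_X * ?l - 2 * fps_X * Y)\<^sup>2"
    by (metis power_mult_distrib)
  also have "\<dots> = (axis_fps x)\<^sup>2 * ((1 - fps_X * ?l)\<^sup>2 - 4 * fps_X\<^sup>2)"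
    by (simp only: kernel_root_square[OF Y] row_fps_0[OF x])
  finally show ?thesis by simp
qed

lemma root_0: "root_minus $ 0 = 1" "root_plus $ 0 = 1"
  by (simp_all add: root_minus_def root_plus_def)

text \<open>The kernel equation times c d separates: nonnegative powers of x form \<open>L\<close>,
  those of 1/x form \<open>M\<close> and \<open>T\<close>, so \<open>L\<close> is constant. Its
  value c d is read off at x = 0, where the axis series is 1 because no walk returns to the
  origin.\<close>

lemma slit_fps_square:
  assumes y: "y > 0"
  shows "(slit_fps y)\<^sup>2 = (root_minus - fps_X * fps_const y) * (root_plus - fps_X * fps_const y)"
proof -
  define M where "M y = (root_minus - fps_X * fps_const y) * (root_plus - fps_X * fps_const y)" for y
  define L where "L x = axis_fps x * axis_fps x * M x" for x
  define T where "T y = root_minus * root_plus * (slit_fps y * slit_fps y)" for y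
  have M: "poly_coeffs M" unfolding M_def
    by (intro poly_coeffs_mult poly_coeffs_diff poly_coeffs_const poly_coeffs_fps_const)
  have ax: "poly_coeffs axis_fps" and sl: "poly_coeffs slit_fps"
    unfolding axis_fps_def slit_fps_def by (rule poly_coeffs_Abs_fps)+
  have L: "poly_coeffs L" unfolding L_def by (intro poly_coeffs_mult M ax)
  have T: "poly_coeffs T" unfolding T_def by (intro poly_coeffs_mult poly_coeffs_const sl)
  have eq: "L x * M (1 / x) = T (1 / x)" if "x > 0" for x
  proof -
    have z: "fps_const x * fps_const (1 / x) = 1" using that by simp
    have l: "fps_const (x + 1 / x) = fps_const x + fps_const (1 / x)" by simp
    let ?l = "fps_const (x + 1 / x)"
    have "L x * M (1 / x) = axis_fps x * axis_fps x *
        (((root_minus - fps_X * fps_const x) * (root_minus - fps_X * fps_const (1 / x))) *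
         ((root_plus - fps_X * fps_const x) * (root_plus - fps_X * fps_const (1 / x))))"
      unfolding L_def M_def by (simp only: mult_ac)
    also have "\<dots> = axis_fps x * axis_fps x *
        (((1 - fps_X * ?l - 2 * fps_X) * root_minus) * ((1 - fps_X * ?l + 2 * fps_X) * root_plus))"
      by (simp only: root_factorization[OF root_relations(1,2) z l])
    also have "\<dots> = root_minus * root_plus * ((axis_fps x)\<^sup>2 * ((1 - fps_X * ?l)\<^sup>2 - 4 * fps_X\<^sup>2))"
      by algebra
    also have "\<dots> = T (1 / x)"
      using that by (simp only: axis_kernel_equation) (simp add: T_def power2_eq_square)
    finally show ?thesis .
  qed
  have "M y $ 0 = 1" for y by (simp add: M_def root_0)
  from wiener_hopf_const[OF L M T this eq] have const: "L x = L 0" for x .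
  have "axis_fps 0 = 1"
  proof (rule fps_ext)
    fix n
    have "axis_fps 0 $ n = walks 0 0 n"
      by (simp add: axis_fps_def power_0_left if_distrib sum.delta cong: if_cong)
    also have "\<dots> = 1 $ n" by (cases n) (simp_all add: walks_0 walks_Suc mem_slit)
    finally show "axis_fps 0 $ n = 1 $ n" .
  qed
  then have L0: "L 0 = root_minus * root_plus" by (simp add: L_def M_def)
  have "L (1 / y) * M y = T y" using eq[of "1 / y"] y by simp
  then have "root_minus * root_plus * M y = root_minus * root_plus * (slit_fps y)\<^sup>2"
    unfolding const[of "1 / y"] L0 T_def power2_eq_square .
  moreover have "root_minus \<noteq> 0" "root_plus \<noteq> 0" using root_0 by auto
  ultimately show ?thesis unfolding M_def by simp
qed

text \<open>For each power of t, the two sides of the formula for S(y)^2 are polynomials in y that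
  agree for all y > 0. Comparing their coefficients removes y, so that a power series can take its
  place.\<close>

lemma slit_coeff_convolution:
  "(\<Sum>k\<le>m. slit_coeff k * slit_coeff (m - k)) =
    (if m = 0 then root_minus * root_plus else if m = 1 then - fps_X * (root_minus + root_plus)
     else if m = 2 then fps_X\<^sup>2 else 0)" (is "_ = ?q m")
proof (rule fps_ext)
  fix n
  define b where "b j = (\<Sum>k\<le>j. monom (slit_coeff k $ j) k)" for j
  have b: "coeff (b j) k = slit_coeff k $ j" for j k
    by (simp add: b_def coeff_sum slit_coeff_eq_0 if_distrib sum.delta cong: if_cong)
  have slit: "slit_fps y $ j = poly (b j) y" for y j
    by (simp add: slit_fps_def b_def poly_sum poly_monom)
  define Q where "Q = [: ?q 0 $ n, ?q 1 $ n, ?q 2 $ n :]"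
  have "poly (\<Sum>j\<le>n. b j * b (n - j)) y = poly Q y" if "y > 0" for y
  proof -
    have "poly (\<Sum>j\<le>n. b j * b (n - j)) y = (slit_fps y)\<^sup>2 $ n"
      by (simp add: power2_eq_square fps_mult_nth slit poly_sum atMost_atLeast0)
    also have "(slit_fps y)\<^sup>2 = ?q 0 + fps_const y * ?q 1 + fps_const (y\<^sup>2) * ?q 2"
      unfolding slit_fps_square[OF that] by (simp add: power2_eq_square algebra_simps flip: fps_const_mult)
    also have "\<dots> $ n = poly Q y" by (simp add: Q_def power2_eq_square algebra_simps)
    finally show ?thesis .
  qed
  then have "{0<..} \<subseteq> {y. poly ((\<Sum>j\<le>n. b j * b (n - j)) - Q) y = 0}" by auto
  then have "(\<Sum>j\<le>n. b j * b (n - j)) - Q = 0"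
    using poly_roots_finite infinite_Ioi finite_subset by metis
  then have "coeff (\<Sum>j\<le>n. b j * b (n - j)) m = coeff Q m" by simp
  moreover have "coeff Q m = ?q m $ n"
    by (auto simp: Q_def coeff_pCons numeral_2_eq_2 split: nat.splits)
  moreover have "coeff (\<Sum>j\<le>n. b j * b (n - j)) m = (\<Sum>k\<le>m. slit_coeff k * slit_coeff (m - k)) $ n"
    unfolding coeff_sum coeff_mult b fps_sum_nth fps_mult_nth atMost_atLeast0
    by (rule sum.swap)
  ultimately show "(\<Sum>k\<le>m. slit_coeff k * slit_coeff (m - k)) $ n = ?q m $ n" by simp
qed

subsection \<open>The diagonal series\<close>

text \<open>\<open>F\<close> is S evaluated at the power series \<xi>, expressed by t-adic
  convergence of the partial sums. In the square of a partial sum, terms with k + l > n have order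
  above n in t; the others group by m = k + l into convolutions, which vanish for m > 2.\<close>

lemma slit_series_square:
  assumes conv: "\<And>N. fps_X ^ Suc N dvd F - (\<Sum>k\<le>N. slit_coeff k * \<xi> ^ k)" and \<xi>: "fps_X dvd \<xi>"
  shows "F\<^sup>2 = (root_minus - fps_X * \<xi>) * (root_plus - fps_X * \<xi>)" (is "_ = ?rhs")
proof -
  have "fps_X ^ N dvd F\<^sup>2 - ?rhs" for N
  proof -
    \<comment> \<open>At least 2, so that m = 0, 1, 2 all occur.\<close>
    define n where "n = N + 2"
    define S where "S = (\<Sum>k\<le>n. slit_coeff k * \<xi> ^ k)"
    let ?f = "\<lambda>(k, l). (slit_coeff k * \<xi> ^ k) * (slit_coeff l * \<xi> ^ l)"
    have "F\<^sup>2 - S\<^sup>2 = (F - S) * (F + S)" by (simp add: power2_eq_square algebra_simps)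
    then have 1: "fps_X ^ Suc n dvd F\<^sup>2 - S\<^sup>2" using conv[of n] by (simp only: S_def dvd_mult2)
    have "S\<^sup>2 = sum ?f ({..n} \<times> {..n})"
      by (simp add: S_def power2_eq_square sum_product sum.cartesian_product)
    also have "\<dots> = sum ?f {(k, l). k + l \<le> n} + sum ?f ({..n} \<times> {..n} - {(k, l). k + l \<le> n})"
      by (subst add.commute, rule sum.subset_diff) auto
    also have "sum ?f {(k, l). k + l \<le> n} = (\<Sum>m\<le>n. \<Sum>k\<le>m. (slit_coeff k * \<xi> ^ k) * (slit_coeff (m - k) * \<xi> ^ (m - k)))"
      by (rule sum.triangle_reindex_eq)
    also have "\<dots> = (\<Sum>m\<le>n. (\<Sum>k\<le>m. slit_coeff k * slit_coeff (m - k)) * \<xi> ^ m)"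
    proof (intro sum.cong refl)
      fix m
      have "(slit_coeff k * \<xi> ^ k) * (slit_coeff (m - k) * \<xi> ^ (m - k)) =
          slit_coeff k * slit_coeff (m - k) * \<xi> ^ m" if "k \<le> m" for k
      proof -
        have "\<xi> ^ m = \<xi> ^ k * \<xi> ^ (m - k)" using that by (simp flip: power_add)
        then show ?thesis by (simp only: mult_ac)
      qed
      then show "(\<Sum>k\<le>m. (slit_coeff k * \<xi> ^ k) * (slit_coeff (m - k) * \<xi> ^ (m - k))) =
          (\<Sum>k\<le>m. slit_coeff k * slit_coeff (m - k)) * \<xi> ^ m"
        unfolding sum_distrib_right by (intro sum.cong) auto
    qed
    also have "\<dots> = (\<Sum>m\<in>{0, 1, 2}. (\<Sum>k\<le>m. slit_coeff k * slit_coeff (m - k)) * \<xi> ^ m)"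
      by (rule sum.mono_neutral_right) (auto simp: slit_coeff_convolution n_def)
    also have "\<dots> = ?rhs"
      by (simp add: slit_coeff_convolution) (simp add: power2_eq_square algebra_simps)
    finally have "S\<^sup>2 - ?rhs = sum ?f ({..n} \<times> {..n} - {(k, l). k + l \<le> n})" by simp
    moreover have "fps_X ^ Suc n dvd sum ?f ({..n} \<times> {..n} - {(k, l). k + l \<le> n})"
    proof (rule dvd_sum)
      fix kl assume "kl \<in> {..n} \<times> {..n} - {(k, l). k + l \<le> n}"
      then obtain k l where kl: "kl = (k, l)" "Suc n \<le> k + l" by (cases kl) auto
      have "fps_X ^ Suc n dvd \<xi> ^ (k + l)"
        using kl(2) \<xi> by (meson dvd_power_same dvd_trans le_imp_power_dvd)
      then have "fps_X ^ Suc n dvd slit_coeff k * slit_coeff l * \<xi> ^ (k + l)" by (rule dvd_mult)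
      then show "fps_X ^ Suc n dvd ?f kl" by (simp add: kl(1) power_add mult_ac)
    qed
    ultimately have "fps_X ^ Suc n dvd S\<^sup>2 - ?rhs" by simp
    from dvd_add[OF 1 this] have "fps_X ^ Suc n dvd F\<^sup>2 - ?rhs" by simp
    then show ?thesis by (rule dvd_trans[OF le_imp_power_dvd, rotated]) (simp add: n_def)
  qed
  then have "F\<^sup>2 - ?rhs = 0" by (rule fps_X_power_dvd_imp_eq_0)
  then show ?thesis by simp
qed

text \<open>Old remainder plus new summand gives the new remainder: W = V^N, and \<open>Dm\<close>,
  \<open>D\<close>, \<open>Dp\<close> belong to the diagonals -N, -N-1, -N-2.\<close>

lemma telescope_step:
  fixes V T Dm D Dp R :: "'a :: comm_ring_1"
  assumes "V = T * (1 + V * V)"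
  shows "T * W * (V * Dm - D) + V * W * (D - T * (Dp + Dm)) = T * (V * W) * (V * D - Dp)"
proof -
  have "T * W * (V * Dm - D) + V * W * (D - T * (Dp + Dm)) = (V - T) * (W * D) - T * V * W * Dp"
    by (simp add: algebra_simps)
  also have "V - T = T * (1 + V * V) - T" using assms by (rule arg_cong)
  also have "(T * (1 + V * V) - T) * (W * D) - T * V * W * Dp = T * (V * W) * (V * D - Dp)"
    by (simp add: algebra_simps)
  finally show ?thesis .
qed

text \<open>Multiplying the equation of diagonal -k by V^k gives the slit term
  \<open>slit_coeff k * \<xi> ^ k\<close>, the weight p^(-k) being absorbed by \<xi> = V/p. As V = T
  (1 + V^2) with T = t (p + 1/p), the sum over k telescopes; diagonal 1 enters as V times diagonal
  0, and \<open>diag_fps p 0 * R\<close> = S(\<xi>) remains.\<close>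

lemma diag_kernel_equation:
  assumes p: "p \<noteq> 0" and V: "V = fps_X * (fps_const (p + 1 / p) + 0 * V + fps_const (p + 1 / p) * V\<^sup>2)"
  defines "\<xi> \<equiv> fps_const (1 / p) * V" and "R \<equiv> 1 - 2 * (fps_X * fps_const (p + 1 / p)) * V"
  shows "(diag_fps p 0 * R)\<^sup>2 = (root_minus - fps_X * \<xi>) * (root_plus - fps_X * \<xi>)"
proof -
  let ?U = "fps_const (p + 1 / p)"
  let ?D = "diag_fps p"
  have up: "?D (int j) = V ^ j * ?D 0" for j
  proof -
    have "?D (int (Suc j)) = fps_X * (?U * ?D (int j) + 0 * ?D (int (Suc j)) + ?U * ?D (int (Suc (Suc j))))" for j
      by (subst diag_fps_eq[OF p]) (simp add: add_ac distrib_left)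
    then show ?thesis
      using fps_recurrence_geometric[OF V, of "\<lambda>j. ?D (int j)"] by simp
  qed
  have D1: "?D 1 = V * ?D 0" using up[of 1] by simp
  have VT: "V = fps_X * ?U * (1 + V * V)"
  proof -
    have "fps_X * (?U + 0 * V + ?U * V\<^sup>2) = fps_X * ?U * (1 + V * V)"
      by (simp add: power2_eq_square distrib_left mult.assoc)
    with V show ?thesis by (rule trans)
  qed
  have summand: "slit_coeff k * \<xi> ^ k = V ^ k * (?D (- int k) - fps_X * ?U * (?D (- int k - 1) + ?D (- int k + 1)))" for k
  proof -
    have "?D (- int k) - fps_X * ?U * (?D (- int k - 1) + ?D (- int k + 1)) = fps_const (p powi (- int k)) * slit_coeff k"
      by (subst diag_fps_eq[OF p]) (simp add: mult.assoc)
    moreover have "fps_const (p powi (- int k)) = fps_const (1 / p) ^ k"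
      by (simp add: fps_const_power power_int_minus power_one_over inverse_eq_divide)
    ultimately show ?thesis by (simp only: \<xi>_def power_mult_distrib mult_ac)
  qed
  have partial: "(\<Sum>k\<le>N. slit_coeff k * \<xi> ^ k) =
      ?D 0 * R + fps_X * ?U * V ^ N * (V * ?D (- int N) - ?D (- int N - 1))" for N
  proof (induction N)
    case 0
    show ?case using summand[of 0] D1 by (simp add: R_def algebra_simps)
  next
    case (Suc N)
    have i: "- int (Suc N) - 1 = - int N - 2" "- int (Suc N) + 1 = - int N" "- int (Suc N) = - int N - 1" by simp_all
    show ?case
      unfolding sum.atMost_Suc Suc.IH summand[of "Suc N"]
      unfolding i(1,2)
      unfolding i(3) power_Suc add.assoc
      by (rule arg_cong[where f = "\<lambda>u. ?D 0 * R + u"], rule telescope_step[OF VT])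
  qed
  have XV: "fps_X dvd V" by (subst VT) (simp add: mult.assoc)
  show ?thesis
  proof (rule slit_series_square)
    show "fps_X dvd \<xi>" unfolding \<xi>_def using XV by (rule dvd_mult)
    fix N
    have "fps_X ^ Suc N dvd fps_X * V ^ N * (?U * (V * ?D (- int N) - ?D (- int N - 1)))"
      unfolding power_Suc by (intro dvd_mult2 mult_dvd_mono dvd_refl dvd_power_same XV)
    moreover have "?D 0 * R - (\<Sum>k\<le>N. slit_coeff k * \<xi> ^ k) =
        - (fps_X * V ^ N * (?U * (V * ?D (- int N) - ?D (- int N - 1))))"
      unfolding partial by (simp add: mult_ac)
    ultimately show "fps_X ^ Suc N dvd ?D 0 * R - (\<Sum>k\<le>N. slit_coeff k * \<xi> ^ k)"
      by simp
  qed
qed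

section \<open>The closed form of the diagonal series\<close>

definition cbin :: "nat \<Rightarrow> real" where
  "cbin i = real (2 * i choose i) / 4 ^ i"

lemma cbin_pochhammer: "cbin i = pochhammer (1 / 2) i / fact i"
proof -
  have "real (2 * i choose i) = fact (2 * i) / (fact i * fact i)"
    using binomial_fact[of i "2 * i", where ?'a = real] by simp
  then show ?thesis by (simp add: cbin_def pochhammer_half)
qed

lemma cbin_Suc: "cbin (Suc i) = cbin i * (2 * real i + 1) / (2 * real i + 2)"
proof -
  have "cbin (Suc i) = pochhammer (1 / 2) i * (1 / 2 + real i) / ((real i + 1) * fact i)"
    by (simp add: cbin_pochhammer pochhammer_Suc add.commute)
  also have "\<dots> = cbin i * ((1 / 2 + real i) / (real i + 1))"
    by (simp add: cbin_pochhammer)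
  also have "(1 / 2 + real i) / (real i + 1) = (2 * real i + 1) / (2 * real i + 2)"
    by (simp add: divide_simps)
  finally show ?thesis by simp
qed

lemma cbin_fps_square: "(Abs_fps cbin)\<^sup>2 * (1 - fps_X) = 1"
proof -
  let ?b = "fps_binomial (- 1 / 2 :: real)"
  have "Abs_fps cbin = ?b oo - fps_X"
    by (rule fps_ext) (simp add: fps_compose_uminus' cbin_pochhammer gbinomial_pochhammer)
  moreover have "?b * ?b * (1 + fps_X) = 1"
  proof -
    have "?b * ?b = inverse (1 + fps_X)"
      using fps_binomial_add_mult[of "- 1 / 2 :: real" "- 1 / 2"] by (simp add: fps_binomial_minus_one)
    then show ?thesis by (simp add: inverse_mult_eq_1)
  qed
  then have "(?b * ?b * (1 + fps_X)) oo (- fps_X) = 1 oo (- fps_X)" by simp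
  then have "(?b oo - fps_X) * (?b oo - fps_X) * (1 - fps_X) = 1"
    by (simp add: fps_compose_mult_distrib fps_compose_add_distrib)
  ultimately show ?thesis by (simp add: power2_eq_square)
qed

definition inv_sqrt_fps :: "real \<Rightarrow> real fps" where
  "inv_sqrt_fps z = Abs_fps cbin oo (fps_const z * (cat_even\<^sup>2 - 1))"

lemma cat_even_square_0: "(cat_even\<^sup>2 - 1) $ 0 = 0"
  by (simp add: power2_eq_square cat_even_0)

lemma inv_sqrt_fps_square: "(inv_sqrt_fps z)\<^sup>2 * (1 - (cat_even\<^sup>2 - 1) * fps_const z) = 1"
proof -
  let ?g = "fps_const z * (cat_even\<^sup>2 - 1)"
  have 0: "?g $ 0 = 0" using cat_even_square_0 by simp
  have "(inv_sqrt_fps z)\<^sup>2 * (1 - ?g) = ((Abs_fps cbin)\<^sup>2 * (1 - fps_X)) oo ?g"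
    unfolding inv_sqrt_fps_def power2_eq_square[of "Abs_fps cbin"] power2_eq_square[of "Abs_fps cbin oo _"]
      fps_compose_mult_distrib[OF 0] fps_compose_sub_distrib fps_compose_1 fps_X_fps_compose_startby0[OF 0] ..
  then show ?thesis by (simp only: cbin_fps_square fps_compose_1 mult.commute[of _ "fps_const z"])
qed

lemma inv_sqrt_fps_0: "inv_sqrt_fps z $ 0 = 1"
  by (simp add: inv_sqrt_fps_def cbin_def)

lemma diag_fps_0_0: "diag_fps p 0 $ 0 = 1"
proof -
  have "Sum_any (\<lambda>i. walks i (i - 0) 0 * p powi (2 * i - 0)) = Sum_any (\<lambda>i::int. if i = 0 then 1 else 0)"
    by (rule Sum_any.cong) (auto simp: walks_0)
  then show ?thesis by (simp add: diag_fps_def)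
qed

text \<open>Multiplied by R, both sides have the same square: one by
  \<open>diag_kernel_equation\<close>, the other by \<open>diagonal_square_identity\<close>. The
  common constant term 2 (1 + z) > 0 excludes opposite signs.\<close>

lemma diag_fps_closed_form:
  assumes p: "p > 0"
  defines "z \<equiv> p\<^sup>2"
  shows "2 * fps_const (1 + z) * diag_fps p 0 = fps_const (1 + z) * inv_sqrt_fps z +
    cat_even * (fps_const z * inv_sqrt_fps z + inv_sqrt_fps (1 / z))" (is "?D = ?E")
proof -
  let ?U = "fps_const (p + 1 / p)"
  have z: "z > 0" using p by (simp add: z_def)
  obtain V :: "real fps" where V: "V = fps_X * (?U + 0 * V + ?U * V\<^sup>2)"
    by (rule fps_quadratic_fixpoint)
  define R where "R = 1 - 2 * (fps_X * ?U) * V"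
  define \<xi> where "\<xi> = fps_const (1 / p) * V"
  define P where "P = inv_sqrt_fps z"
  define N where "N = inv_sqrt_fps (1 / z)"
  let ?Z = "fps_const z" and ?Zi = "fps_const (1 / z)"
  have ZZ: "?Z * ?Zi = 1" using z by simp
  have D: "(diag_fps p 0 * R)\<^sup>2 = (root_minus - fps_X * \<xi>) * (root_plus - fps_X * \<xi>)"
    unfolding R_def \<xi>_def using p by (intro diag_kernel_equation V) simp
  have U2: "?U\<^sup>2 = ?Z + 2 + ?Zi"
    using p by (simp add: power2_eq_square z_def numeral_fps_const field_simps)
  have R2: "R\<^sup>2 = 1 - 4 * fps_X\<^sup>2 * (?Z + 2 + ?Zi)"
  proof -
    have "V = (fps_X * ?U) * (1 + 0 * V + 1 * V\<^sup>2)"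
    proof -
      have "fps_X * (?U + 0 * V + ?U * V\<^sup>2) = (fps_X * ?U) * (1 + 0 * V + 1 * V\<^sup>2)"
        by (simp add: distrib_left mult.assoc)
      with V show ?thesis by (rule trans)
    qed
    from kernel_root_square[OF this] show ?thesis
      unfolding U2[symmetric] by (simp add: R_def power_mult_distrib mult.assoc)
  qed
  have R0: "R $ 0 = 1" by (simp add: R_def mult.assoc)
  have P: "P\<^sup>2 * (1 - (cat_even\<^sup>2 - 1) * ?Z) = 1" and N: "N\<^sup>2 * (1 - (cat_even\<^sup>2 - 1) * ?Zi) = 1"
    unfolding P_def N_def by (rule inv_sqrt_fps_square)+
  have P0: "P $ 0 = 1" and N0: "N $ 0 = 1" unfolding P_def N_def by (rule inv_sqrt_fps_0)+
  have PNR: "cat_even\<^sup>2 * P * N * R = 1"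
  proof -
    have "(cat_even\<^sup>2 * P * N * R)\<^sup>2 = 1"
    proof -
      \<comment> \<open>With G = w^2 - 1 the right side is (1 + G)^2 - G (z + 2 + 1/z), and G = 4
        t^2 w^4.\<close>
      have "cat_even ^ 4 * R\<^sup>2 = (1 - (cat_even\<^sup>2 - 1) * ?Z) * (1 - (cat_even\<^sup>2 - 1) * ?Zi)"
        using R2 root_relations(5) ZZ by algebra
      then have "(cat_even\<^sup>2 * P * N * R)\<^sup>2 =
          (P\<^sup>2 * (1 - (cat_even\<^sup>2 - 1) * ?Z)) * (N\<^sup>2 * (1 - (cat_even\<^sup>2 - 1) * ?Zi))"
        by algebra
      then show ?thesis unfolding P N by simp
    qed
    then have "cat_even\<^sup>2 * P * N * R = 1 \<or> cat_even\<^sup>2 * P * N * R = - 1"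
      by (simp only: power2_eq_1_iff)
    moreover have "(cat_even\<^sup>2 * P * N * R) $ 0 = 1"
      by (simp add: power2_eq_square cat_even_0 P0 N0 R0)
    moreover have "(- 1 :: real fps) $ 0 = - 1" by simp
    ultimately show ?thesis by force
  qed
  \<comment> \<open>This expresses t \<xi> through R and z, which eliminates V.\<close>
  have X\<xi>: "2 * (1 + ?Z) * (fps_X * \<xi>) = 1 - R"
  proof -
    have "(1 + ?Z) * fps_const (1 / p) = ?U"
      using p by (simp add: z_def power2_eq_square field_simps flip: fps_const_1_eq_1)
    moreover have "2 * (1 + ?Z) * (fps_X * \<xi>) = 2 * (fps_X * ((1 + ?Z) * fps_const (1 / p))) * V"
      unfolding \<xi>_def by (simp only: mult_ac)
    ultimately show ?thesis by (simp add: R_def)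
  qed
  have E: "?E = (1 + ?Z) * P + cat_even * (?Z * P + N)"
    by (simp add: P_def N_def flip: fps_const_add)
  have "R\<^sup>2 * ?E\<^sup>2 = (2 * (1 + ?Z) * root_minus - (1 - R)) * (2 * (1 + ?Z) * root_plus - (1 - R))"
    unfolding E by (rule diagonal_square_identity[OF ZZ P N R2 PNR root_relations(3,4,5)])
  also have "\<dots> = (2 * (1 + ?Z))\<^sup>2 * ((root_minus - fps_X * \<xi>) * (root_plus - fps_X * \<xi>))"
    unfolding X\<xi>[symmetric] by algebra
  also have "\<dots> = R\<^sup>2 * ?D\<^sup>2"
    unfolding D[symmetric] by (simp add: power_mult_distrib flip: fps_const_add)
  finally have "?E\<^sup>2 = ?D\<^sup>2" using R0 by auto
  then have "?D = ?E \<or> ?D = - ?E" by (metis power2_eq_iff)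
  moreover have "?D $ 0 = 2 * (1 + z)" "?E $ 0 = 2 * (1 + z)"
    by (simp_all add: diag_fps_0_0 cat_even_0 inv_sqrt_fps_0 numeral_fps_const)
  ultimately show ?thesis using z by force
qed

subsection \<open>Coefficients\<close>

lemma fps_mult_compose_scaled_nth:
  fixes G h :: "real fps"
  assumes G: "G $ 0 = 0"
  shows "(h * (f oo (fps_const z * G))) $ n = (\<Sum>i\<le>n. f $ i * z ^ i * (G ^ i * h) $ n)"
proof -
  let ?g = "fps_const z * G"
  have tail: "(f oo ?g) $ k = (\<Sum>i\<le>n. f $ i * (?g ^ i) $ k)" if "k \<le> n" for k
    unfolding fps_compose_nth
  proof (rule sum.mono_neutral_left)
    have "?g $ 0 = 0" using G by simp
    then have "(?g ^ i) $ k = 0" if "k < i" for i using startsby_zero_power_prefix that by blast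
    then show "\<forall>i\<in>{..n} - {0..k}. f $ i * (?g ^ i) $ k = 0" by auto
  qed (use that in auto)
  have "(h * (f oo ?g)) $ n = (\<Sum>j\<le>n. \<Sum>i\<le>n. f $ i * (h $ j * (?g ^ i) $ (n - j)))"
    unfolding fps_mult_nth atMost_atLeast0[symmetric]
    by (intro sum.cong refl) (simp add: tail sum_distrib_left mult.left_commute)
  also have "\<dots> = (\<Sum>i\<le>n. f $ i * (h * ?g ^ i) $ n)"
    by (subst sum.swap) (simp add: fps_mult_nth atMost_atLeast0 sum_distrib_left)
  also have "\<dots> = (\<Sum>i\<le>n. f $ i * z ^ i * (G ^ i * h) $ n)"
  proof (intro sum.cong refl)
    fix i
    have "h * ?g ^ i = fps_const (z ^ i) * (G ^ i * h)"
      by (simp add: power_mult_distrib fps_const_power mult_ac)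
    then show "f $ i * (h * ?g ^ i) $ n = f $ i * z ^ i * (G ^ i * h) $ n"
      by (simp only: fps_mult_left_const_nth mult.assoc)
  qed
  finally show ?thesis .
qed

lemma inv_sqrt_fps_nth:
  "inv_sqrt_fps z $ (2 * m) = (\<Sum>i\<le>2 * m. cbin i * z ^ i * (4 ^ m * ballot 0 i m))"
  "(cat_even * inv_sqrt_fps z) $ (2 * m) = (\<Sum>i\<le>2 * m. cbin i * z ^ i * (4 ^ m * ballot (1 / 2) i m))"
proof -
  have 1: "(cat_even\<^sup>2 - 1) ^ i * 1 = ballot_fps 0 i oo four_X2"
    and 2: "(cat_even\<^sup>2 - 1) ^ i * cat_even = ballot_fps (1 / 2) i oo four_X2" for i
    unfolding ballot_compose_4X2[of _ i] by (simp_all add: ballot_fps_0_0 cat_even_altdef)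
  show "inv_sqrt_fps z $ (2 * m) = (\<Sum>i\<le>2 * m. cbin i * z ^ i * (4 ^ m * ballot 0 i m))"
    using fps_mult_compose_scaled_nth[OF cat_even_square_0, of 1 "Abs_fps cbin" z "2 * m"]
    unfolding 1 by (simp add: inv_sqrt_fps_def fps_compose_4X2_nth ballot_fps_def)
  show "(cat_even * inv_sqrt_fps z) $ (2 * m) = (\<Sum>i\<le>2 * m. cbin i * z ^ i * (4 ^ m * ballot (1 / 2) i m))"
    using fps_mult_compose_scaled_nth[OF cat_even_square_0, of cat_even "Abs_fps cbin" z "2 * m"]
    unfolding 2 by (simp add: inv_sqrt_fps_def fps_compose_4X2_nth ballot_fps_def)
qed

text \<open>\<open>diag_coeff m i\<close> will turn out to be twice the number of walks of length \<open>2m\<close> to \<open>(-i, -i)\<close>;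
  \<open>diag_coeff_add\<close> is what cancels the factor \<open>1 + z\<close> in the closed form.\<close>

definition diag_coeff :: "nat \<Rightarrow> nat \<Rightarrow> real" where
  "diag_coeff m i = (if i \<le> m then cbin i * 4 ^ m * (real i / real m) * ((2 * real m - 1 / 2) gchoose (m - i)) else 0)"

lemma diag_coeff_add:
  assumes m: "m \<ge> 1"
  shows "diag_coeff m (Suc i) + diag_coeff m i = cbin i * (4 ^ m * ballot (1 / 2) i m)"
proof -
  consider "i > m" | "i = m" | "i < m" by linarith
  then show ?thesis
  proof cases
    case 1
    then show ?thesis by (simp add: diag_coeff_def ballot_def gbin_def)
  next
    case 2
    then show ?thesis using ballot_eq[of m m "1 / 2"] m by (simp add: diag_coeff_def)
  next
    case 3
    define k where "k = m - Suc i"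
    have k: "m - i = Suc k" "m - Suc i = k" using 3 by (simp_all add: k_def)
    have rm: "real m = real i + real k + 1" using 3 by (simp add: k_def of_nat_diff)
    \<comment> \<open>All terms are rational multiples of this binomial, with m = i + k + 1.\<close>
    define C where "C = (2 * real m - 1 / 2) gchoose k"
    have up: "real (Suc k) * ((2 * real m - 1 / 2) gchoose Suc k) = (2 * real m - 1 / 2 - real k) * C"
      using gbinomial_absorb_comp[of "2 * real m - 1 / 2" k] gbinomial_absorption[of k "2 * real m - 1 / 2"]
      unfolding C_def by (simp only:)
    have top: "real (Suc k) * ((2 * real m + 1 / 2) gchoose Suc k) = (2 * real m + 1 / 2) * C"
      using gbinomial_absorption[of k "2 * real m + 1 / 2"] by (simp add: C_def)
    have u: "(2 * real m - 1 / 2) gchoose Suc k = (2 * real m - 1 / 2 - real k) * C / real (Suc k)"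
      using up by (simp add: eq_divide_eq mult.commute del: of_nat_Suc)
    have t: "(2 * real m + 1 / 2) gchoose Suc k = (2 * real m + 1 / 2) * C / real (Suc k)"
      using top by (simp add: eq_divide_eq mult.commute del: of_nat_Suc)
    have b: "ballot (1 / 2) i m = (2 * real i + 1 / 2) * C / real (Suc k)"
      using ballot_eq[of i m "1 / 2"] 3 m unfolding k t by simp
    have "(2 * real i + 1) / (2 * real i + 2) * (real (Suc i) / real m) * C +
        real i / real m * ((2 * real m - 1 / 2 - real k) * C / real (Suc k)) =
        (2 * real i + 1 / 2) * C / real (Suc k)"
      unfolding rm by (simp add: divide_simps) (simp add: algebra_simps)
    then have "cbin i * 4 ^ m * ((2 * real i + 1) / (2 * real i + 2) * (real (Suc i) / real m) * C +
        real i / real m * ((2 * real m - 1 / 2 - real k) * C / real (Suc k))) =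
        cbin i * 4 ^ m * ((2 * real i + 1 / 2) * C / real (Suc k))" by (simp only:)
    moreover have "diag_coeff m i = cbin i * 4 ^ m * (real i / real m * ((2 * real m - 1 / 2 - real k) * C / real (Suc k)))"
      unfolding diag_coeff_def k u using 3 by simp
    moreover have "diag_coeff m (Suc i) = cbin i * 4 ^ m * ((2 * real i + 1) / (2 * real i + 2) * (real (Suc i) / real m) * C)"
      unfolding diag_coeff_def k C_def[symmetric] cbin_Suc using 3 by simp
    ultimately show ?thesis unfolding b by (simp only: distrib_left mult.assoc add.commute)
  qed
qed

text \<open>With u(z) the sum on the right, \<open>diag_coeff_add\<close> turns the left side into
  u(z) + z u(z). The index shift loses nothing because \<open>diag_coeff\<close> vanishes at 0 and
  beyond m.\<close>

lemma even_part_nth: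
  assumes m: "m \<ge> 1"
  shows "(\<Sum>i\<le>2 * m. cbin i * z ^ i * (4 ^ m * ballot (1 / 2) i m)) * z =
    (1 + z) * (\<Sum>i\<le>2 * m. diag_coeff m i * z ^ i)"
proof -
  have "(\<Sum>i\<le>2 * m. cbin i * z ^ i * (4 ^ m * ballot (1 / 2) i m)) * z =
      (\<Sum>i\<le>2 * m. diag_coeff m (Suc i) * z ^ Suc i + diag_coeff m i * z ^ i * z)"
    unfolding sum_distrib_right
  proof (intro sum.cong refl)
    fix i
    have "cbin i * z ^ i * (4 ^ m * ballot (1 / 2) i m) * z = (diag_coeff m (Suc i) + diag_coeff m i) * z ^ i * z"
      unfolding diag_coeff_add[OF m] by (simp only: mult_ac)
    then show "cbin i * z ^ i * (4 ^ m * ballot (1 / 2) i m) * z =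
        diag_coeff m (Suc i) * z ^ Suc i + diag_coeff m i * z ^ i * z"
      by (simp add: algebra_simps)
  qed
  also have "\<dots> = (\<Sum>i\<le>2 * m. diag_coeff m (Suc i) * z ^ Suc i) + (\<Sum>i\<le>2 * m. diag_coeff m i * z ^ i) * z"
    by (simp add: sum.distrib sum_distrib_right)
  also have "(\<Sum>i\<le>2 * m. diag_coeff m (Suc i) * z ^ Suc i) = (\<Sum>i\<le>Suc (2 * m). diag_coeff m i * z ^ i)"
    by (subst sum.atMost_Suc_shift) (simp add: diag_coeff_def)
  also have "\<dots> = (\<Sum>i\<le>2 * m. diag_coeff m i * z ^ i)"
    by (simp add: diag_coeff_def)
  finally show ?thesis by (simp add: algebra_simps)
qed

section \<open>Comparison of Laurent coefficients\<close>

lemma laurent_sum_eq_0: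
  fixes d :: "int \<Rightarrow> real"
  assumes "\<And>z. z > 0 \<Longrightarrow> (\<Sum>i\<in>{- int N..int N}. d i * z powi i) = 0" and i: "i \<in> {- int N..int N}"
  shows "d i = 0"
proof -
  define q where "q = (\<Sum>k\<le>2 * N. monom (d (int k - int N)) k)"
  have "poly q z = 0" if "z > 0" for z
  proof -
    have "(\<Sum>i\<in>{- int N..int N}. d i * z powi i) = (\<Sum>k\<le>2 * N. d (int k - int N) * z powi (int k - int N))"
      by (rule sum.reindex_bij_witness[where i = "\<lambda>k. int k - int N" and j = "\<lambda>i. nat (i + int N)"]) auto
    also have "\<dots> = (\<Sum>k\<le>2 * N. d (int k - int N) * z ^ k) / z ^ N"
      using that by (simp add: power_int_diff sum_divide_distrib)
    finally show ?thesis using assms(1)[OF that] that by (simp add: q_def poly_sum poly_monom)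
  qed
  then have "{0<..} \<subseteq> {z. poly q z = 0}" by auto
  then have "q = 0" using poly_roots_finite infinite_Ioi finite_subset by metis
  moreover have "coeff q k = (if k \<le> 2 * N then d (int k - int N) else 0)" for k
    by (simp add: q_def coeff_sum)
  from this[of "nat (i + int N)"] have "coeff q (nat (i + int N)) = d i" using i by auto
  ultimately show ?thesis by simp
qed

lemma diag_fps_nth:
  assumes "p \<noteq> 0"
  shows "diag_fps p 0 $ n = (\<Sum>i\<in>{- int n..int n}. walks i i n * (p\<^sup>2) powi i)"
proof -
  have "Sum_any (\<lambda>i. walks i i n * p powi (2 * i)) = (\<Sum>i\<in>{- int n..int n}. walks i i n * p powi (2 * i))"
    by (rule Sum_any.expand_superset) (use walks_eq_0[of n] in force)+
  then show ?thesis by (simp add: diag_fps_def power_int_mult)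
qed

lemma sum_int_split:
  fixes f :: "int \<Rightarrow> real"
  shows "(\<Sum>i\<in>{- int N..int N}. if i \<ge> 0 then f i else 0) = (\<Sum>i\<le>N. f (int i))"
    and "(\<Sum>i\<in>{- int N..int N}. if i \<le> 0 then f i else 0) = (\<Sum>i\<le>N. f (- int i))"
proof -
  have "(\<Sum>i\<in>{- int N..int N}. if i \<ge> 0 then f i else 0) = (\<Sum>i\<in>{0..int N}. f i)"
    by (rule sum.mono_neutral_cong_right) auto
  also have "\<dots> = (\<Sum>i\<le>N. f (int i))"
    by (rule sum.reindex_bij_witness[where i = int and j = nat]) auto
  finally show "(\<Sum>i\<in>{- int N..int N}. if i \<ge> 0 then f i else 0) = (\<Sum>i\<le>N. f (int i))" .
  have "(\<Sum>i\<in>{- int N..int N}. if i \<le> 0 then f i else 0) = (\<Sum>i\<in>{- int N..0}. f i)"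
    by (rule sum.mono_neutral_cong_right) auto
  also have "\<dots> = (\<Sum>i\<le>N. f (- int i))"
    by (rule sum.reindex_bij_witness[where i = "\<lambda>k. - int k" and j = "\<lambda>i. nat (- i)"]) auto
  finally show "(\<Sum>i\<in>{- int N..int N}. if i \<le> 0 then f i else 0) = (\<Sum>i\<le>N. f (- int i))" .
qed

text \<open>Divided by 1 + z, the closed form reads 2 D = e(z) + u(z) + u(1/z), where u(z) comes
  from w z (1 - G z)^(-1/2) and u(1/z) from w (1 - G/z)^(-1/2). The u-terms treat both directions
  alike; e, with nonnegative powers only, is the excess on the positive side.\<close>

lemma walks_diagonal_coeffs:
  assumes m: "m \<ge> 1" and i: "1 \<le> i" "i \<le> 2 * m"
  shows "2 * walks (- int i) (- int i) (2 * m) = diag_coeff m i"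
    and "2 * walks (int i) (int i) (2 * m) = diag_coeff m i + cbin i * (4 ^ m * ballot 0 i m)"
proof -
  define N where "N = 2 * m"
  define e where "e k = cbin k * (4 ^ m * ballot 0 k m)" for k
  define d where "d k = 2 * walks k k N - (if k \<ge> 0 then e (nat k) else 0)
    - (if k \<ge> 0 then diag_coeff m (nat k) else 0) - (if k \<le> 0 then diag_coeff m (nat (- k)) else 0)" for k
  have "(\<Sum>k\<in>{- int N..int N}. d k * z powi k) = 0" if z: "z > 0" for z
  proof -
    define p where "p = sqrt z"
    have p: "p > 0" "p\<^sup>2 = z" using z by (simp_all add: p_def)
    let ?u = "\<lambda>z. \<Sum>k\<le>N. diag_coeff m k * z ^ k"
    let ?e = "\<Sum>k\<le>N. e k * z ^ k"
    let ?D = "\<Sum>k\<in>{- int N..int N}. walks k k N * z powi k"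
    have "fps_const (2 * (1 + z)) * diag_fps p 0 = 2 * fps_const (1 + z) * diag_fps p 0"
      by (simp add: numeral_fps_const)
    also have "\<dots> = fps_const (1 + z) * inv_sqrt_fps z +
        cat_even * (fps_const z * inv_sqrt_fps z + inv_sqrt_fps (1 / z))"
      using diag_fps_closed_form[OF p(1)] unfolding p(2) .
    also have "\<dots> = fps_const (1 + z) * inv_sqrt_fps z +
        (fps_const z * (cat_even * inv_sqrt_fps z) + cat_even * inv_sqrt_fps (1 / z))"
      by (simp only: distrib_left mult.left_commute)
    finally have "(fps_const (2 * (1 + z)) * diag_fps p 0) $ N =
        (fps_const (1 + z) * inv_sqrt_fps z + (fps_const z * (cat_even * inv_sqrt_fps z) + cat_even * inv_sqrt_fps (1 / z))) $ N"
      by (rule arg_cong)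
    then have "2 * (1 + z) * diag_fps p 0 $ N = (1 + z) * inv_sqrt_fps z $ N +
        (z * (cat_even * inv_sqrt_fps z) $ N + (cat_even * inv_sqrt_fps (1 / z)) $ N)"
      by (simp only: fps_mult_left_const_nth fps_add_nth)
    also have "diag_fps p 0 $ N = ?D" using diag_fps_nth[of p N] p by simp
    also have "inv_sqrt_fps z $ N = ?e"
      unfolding N_def inv_sqrt_fps_nth by (simp add: e_def mult_ac)
    also have "z * (cat_even * inv_sqrt_fps z) $ N = (1 + z) * ?u z"
      unfolding N_def inv_sqrt_fps_nth using even_part_nth[OF m, of z] by (simp only: mult.commute)
    also have "(cat_even * inv_sqrt_fps (1 / z)) $ N = (1 + z) * ?u (1 / z)"
    proof -
      have "(cat_even * inv_sqrt_fps (1 / z)) $ N * (1 / z) = (1 + 1 / z) * ?u (1 / z)"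
        unfolding N_def inv_sqrt_fps_nth by (rule even_part_nth[OF m])
      then have "(cat_even * inv_sqrt_fps (1 / z)) $ N = z * ((1 + 1 / z) * ?u (1 / z))"
        using z by (simp add: divide_eq_eq mult.commute)
      also have "\<dots> = (z * (1 + 1 / z)) * ?u (1 / z)" by (simp only: mult.assoc)
      also have "z * (1 + 1 / z) = 1 + z" using z by (simp add: distrib_left)
      finally show ?thesis .
    qed
    finally have "(1 + z) * (2 * ?D) = (1 + z) * (?e + ?u z + ?u (1 / z))"
      by (simp add: algebra_simps)
    then have main: "2 * ?D = ?e + ?u z + ?u (1 / z)" using z by simp
    have "(\<Sum>k\<in>{- int N..int N}. d k * z powi k) = 2 * ?D
        - (\<Sum>k\<in>{- int N..int N}. if k \<ge> 0 then e (nat k) * z powi k else 0)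
        - (\<Sum>k\<in>{- int N..int N}. if k \<ge> 0 then diag_coeff m (nat k) * z powi k else 0)
        - (\<Sum>k\<in>{- int N..int N}. if k \<le> 0 then diag_coeff m (nat (- k)) * z powi k else 0)"
      unfolding sum_distrib_left sum_subtractf[symmetric]
      by (intro sum.cong refl) (auto simp: d_def algebra_simps)
    also have "\<dots> = 2 * ?D - ?e - ?u z - ?u (1 / z)"
      unfolding sum_int_split by (simp add: power_int_minus power_one_over inverse_eq_divide)
    finally show ?thesis using main by simp
  qed
  from laurent_sum_eq_0[where d = d and N = N, OF this] have d: "d k = 0" if "k \<in> {- int N..int N}" for k
    using that by blast
  have "d (- int i) = 0" "d (int i) = 0" by (rule d, use i in \<open>simp add: N_def\<close>)+
  then show "2 * walks (- int i) (- int i) (2 * m) = diag_coeff m i"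
    "2 * walks (int i) (int i) (2 * m) = diag_coeff m i + cbin i * (4 ^ m * ballot 0 i m)"
    using i by (simp_all add: d_def e_def N_def)
qed

theorem mainTheorem5:
  fixes i n :: nat
  assumes "i \<ge> 1" and "n \<ge> i"
  shows "real (slit_walk_count (- int i) (- int i) (2 * n)) =
           real i / real (2 * n) * real ((2 * i) choose i) * real ((n + i) choose (2 * i))
           * (real ((4 * n) choose (2 * n)) / real ((2 * n + 2 * i) choose (2 * i)))
       \<and> real (slit_walk_count (int i) (int i) (2 * n)) =
           real (slit_walk_count (- int i) (- int i) (2 * n))
           + 4 ^ (n - i) * (real i / real (2 * n)) * real ((2 * i) choose i)
             * real ((2 * n) choose (n - i))"
proof -
  have n: "n \<ge> 1" and i2: "i \<le> 2 * n" using assms by simp_all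
  \<comment> \<open>The denominator 4^i of \<open>cbin\<close> leaves 4^(n - i). This power cancels
    against the half-integer binomial for (-i, -i) and survives in the extra summand for (i,
    i).\<close>
  have "(4::real) ^ n = 4 ^ i * 4 ^ (n - i)" using assms by (simp flip: power_add)
  then have c: "cbin i * 4 ^ n = real (2 * i choose i) * 4 ^ (n - i)"
    by (simp add: cbin_def)
  have neg: "2 * walks (- int i) (- int i) (2 * n) = real (2 * i choose i) * 4 ^ (n - i) * (real i / real n) *
      ((2 * real n - 1 / 2) gchoose (n - i))"
    unfolding walks_diagonal_coeffs(1)[OF n assms(1) i2] diag_coeff_def c using assms by simp
  have "(2 * real n - 1 / 2) gchoose (n - i) =
      fact (4 * n) * fact (n + i) / (4 ^ (n - i) * fact (2 * n) * fact (2 * n + 2 * i) * fact (n - i))"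
  proof -
    have "real (2 * n) = 2 * real n" "2 * (2 * n) = 4 * n" "2 * n - (n - i) = n + i"
      "2 * (n + i) = 2 * n + 2 * i" "n - i \<le> 2 * n" using assms by simp_all
    then show ?thesis using gbinomial_half[of "n - i" "2 * n"] by (simp only:)
  qed
  then have "2 * walks (- int i) (- int i) (2 * n) = real (2 * i choose i) * (real i / real n) *
      (fact (4 * n) * fact (n + i) / (fact (2 * n) * fact (2 * n + 2 * i) * fact (n - i)))"
    unfolding neg by simp
  moreover have "real ((n + i) choose (2 * i)) = fact (n + i) / (fact (2 * i) * fact (n - i))"
  proof -
    have "n + i - 2 * i = n - i" by simp
    then show ?thesis using binomial_fact[of "2 * i" "n + i", where ?'a = real] assms by simp
  qed
  moreover have "real ((4 * n) choose (2 * n)) = fact (4 * n) / (fact (2 * n) * fact (2 * n))"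
    using binomial_fact[of "2 * n" "4 * n", where ?'a = real] by simp
  moreover have "real ((2 * n + 2 * i) choose (2 * i)) = fact (2 * n + 2 * i) / (fact (2 * i) * fact (2 * n))"
    using binomial_fact[of "2 * i" "2 * n + 2 * i", where ?'a = real] by simp
  ultimately have "2 * walks (- int i) (- int i) (2 * n) = 2 * (real i / real (2 * n) *
      real ((2 * i) choose i) * real ((n + i) choose (2 * i))
      * (real ((4 * n) choose (2 * n)) / real ((2 * n + 2 * i) choose (2 * i))))"
    by (simp add: mult_ac)
  then have "walks (- int i) (- int i) (2 * n) =
      real i / real (2 * n) * real ((2 * i) choose i) * real ((n + i) choose (2 * i))
      * (real ((4 * n) choose (2 * n)) / real ((2 * n + 2 * i) choose (2 * i)))"
    by linarith
  moreover have "ballot 0 i n = real i / real n * real ((2 * n) choose (n - i))"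
    using ballot_eq[of i n 0] n assms by (simp add: binomial_gbinomial)
  then have "2 * walks (int i) (int i) (2 * n) = 2 * walks (- int i) (- int i) (2 * n) +
      real (2 * i choose i) * 4 ^ (n - i) * (real i / real n * real ((2 * n) choose (n - i)))"
    using walks_diagonal_coeffs[OF n assms(1) i2] c by (simp only: mult.assoc[symmetric])
  then have "walks (int i) (int i) (2 * n) = walks (- int i) (- int i) (2 * n) +
      4 ^ (n - i) * (real i / real (2 * n)) * real ((2 * i) choose i) * real ((2 * n) choose (n - i))"
  proof -
    have "4 ^ (n - i) * (real i / real (2 * n)) * real ((2 * i) choose i) * real ((2 * n) choose (n - i)) =
        real (2 * i choose i) * 4 ^ (n - i) * (real i / real n * real ((2 * n) choose (n - i))) / 2"
      by (simp add: mult_ac)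
    moreover have "w = v + s" if "2 * w = 2 * v + t" "s = t / 2" for v w s t :: real
      using that by simp
    ultimately show ?thesis using \<open>2 * walks (int i) (int i) (2 * n) = _\<close> by blast
  qed
  ultimately show ?thesis unfolding walks_def by blast
qed

end
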